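(* Let $d\mu_0=(2\pi)^{-N/2}e^{-|x|^2/2}dx$ be the standard Gaussian measure on $\mathbb{R}^N$. For all $u\in X_0$, $$\int_{\mathbb{R}^N}|\nabla u|^2d\mu_0-\int_{\mathbb{R}^N}\left|u-\int_{\mathbb{R}^N}u\,d\mu_0\right|^2d\mu_0\ge\frac12\int_{\mathbb{R}^N}\left|\nabla u-\int_{\mathbb{R}^N}ux\,d\mu_0\right|^2d\mu_0\ge\int_{\mathbb{R}^N}\left|u-\int_{\mathbb{R}^N}u\,d\mu_0-\left(\int_{\mathbb{R}^N}ux\,d\mu_0\right)\cdot x\right|^2d\mu_0.$$ Moreover, equality (in these inequalities) is attained by some non-linear functions $u\in X_0$.
   Context: $X_0$ is the completion of $C_0^\infty(\mathbb{R}^N)$ under the norm $\left(\int_{\mathbb{R}^N}|u|^2d\mu_0\right)^{1/2}+\left(\int_{\mathbb{R}^N}|\nabla u|^2d\mu_0\right)^{1/2}$. Here $\int_{\mathbb{R}^N}ux\,d\mu_0\in\mathbb{R}^N$ is the vector with components $\int u x_i\,d\mu_0$. *)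

theory Defs
  imports "HOL-Analysis.Analysis"
begin

definition mu0 :: "('a::euclidean_space) measure" where
  "mu0 = density lborel
     (\<lambda>x. ennreal ((2 * pi) powr (- real DIM('a) / 2) * exp (- (norm x)\<^sup>2 / 2)))"

definition smooth_fun :: "('a::euclidean_space \<Rightarrow> real) \<Rightarrow> bool" where
  "smooth_fun u \<longleftrightarrow> (\<exists>F. u \<in> F \<and> (\<forall>g\<in>F. continuous_on UNIV g \<and>
      (\<exists>g'. (\<forall>x. (g has_derivative g' x) (at x)) \<and> (\<forall>i\<in>Basis. (\<lambda>x. g' x i) \<in> F))))"

definition Cc_inf :: "('a::euclidean_space \<Rightarrow> real) set" where
  "Cc_inf = {\<phi>. smooth_fun \<phi> \<and> compact (closure {x. \<phi> x \<noteq> 0})}"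

text \<open>Element of X_0 (completion of C_0^infinity under the Gaussian H^1 norm),
  represented by the pair (u, G) with G the gradient of u: the limit in L^2(mu0) of
  (phi_n, grad phi_n) for a sequence of C_0^infinity functions phi_n.\<close>
definition X0 :: "('a::euclidean_space \<Rightarrow> real) \<Rightarrow> ('a \<Rightarrow> 'a) \<Rightarrow> bool" where
  "X0 u G \<longleftrightarrow> u \<in> borel_measurable borel \<and> G \<in> borel_measurable borel \<and>
     (\<exists>\<phi> G\<phi>. (\<forall>n. \<phi> n \<in> Cc_inf \<and> (\<forall>x. (\<phi> n has_derivative (\<lambda>h. G\<phi> n x \<bullet> h)) (at x))) \<and>
        (\<lambda>n. \<integral>\<^sup>+ x. ennreal ((\<phi> n x - u x)\<^sup>2) \<partial>mu0) \<longlonglongrightarrow> 0 \<and>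
        (\<lambda>n. \<integral>\<^sup>+ x. ennreal ((norm (G\<phi> n x - G x))\<^sup>2) \<partial>mu0) \<longlonglongrightarrow> 0)"

end

theory Submission
  imports Defs "HOL-Probability.Distributions"
begin

text \<open>
  Let c be the vector of first moments of u; integration by parts shows that it is also the mean of
  the gradient. Expanding the squares, both inequalities are equivalent to
  Var u \<le> (\<parallel>grad u\<parallel>^2 + |c|^2) / 2, and it suffices to prove this for test functions.
  Let P_r be the Mehler semigroup and h(r) = \<parallel>P_r u\<parallel>^2 for r in [0,1], so that h(1) - h(0) = Var u.
  Gaussian integration by parts gives h' = sum_i \<parallel>P_r (d_i u)\<parallel>^2; hence all derivatives of h are
  nonnegative, h' is convex, and the trapezoidal rule overestimates the integral of h' over [0,1]:
  h(1) - h(0) \<le> (h'(0) + h'(1)) / 2. This is the claim. Equality holds when h is quadratic, that is,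
  for polynomials of degree two such as |x|^2.
\<close>

text \<open>The parameter r turns h into a power series: if a_k is the squared norm of the Hermite
  component of u of degree k, then h(r) is the sum of the a_k r^k. The claim compares the sum of the
  a_k over k >= 1 with a_1 plus half the sum of the k a_k over k >= 2, so equality fails as soon as
  some a_k with k >= 3 is nonzero. Using signs of derivatives instead of coefficients avoids Hermite
  expansions: one formula for h', applied again to the partial derivatives of u, gives all higher
  derivatives. The delicate points are the ends of [0,1], where the square roots of r and 1 - r are
  not both differentiable. Derivatives are therefore computed for 0 < r < 1 only, and continuity
  brings in the end values: |c|^2 at r = 0 and the squared norm of the gradient at r = 1. Test
  functions have bounded partial derivatives of every order, which justifies every exchange of limit
  and integral. The extremal |x|^2 is not a test function, so its membership in the completion needs
  explicit cut-offs.\<close>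

section \<open>Normalisation of the Gaussian measure and exponential moments\<close>

lemma nn_integral_normal_density_prod:
  fixes s :: real
  assumes "s > 0"
  shows "(\<integral>\<^sup>+x. (\<Prod>b\<in>Basis. ennreal (normal_density 0 s (x \<bullet> b))) \<partial>(lborel :: 'a::euclidean_space measure)) = 1"
proof -
  have "(\<integral>\<^sup>+x. ennreal (normal_density 0 s x) \<partial>lborel) = 1"
    using assms by (subst nn_integral_eq_integral) auto
  then show ?thesis
    by (subst nn_integral_lborel_prod) auto
qed

lemma norm_sq_eq_sum_Basis:
  fixes x :: "'a::euclidean_space"
  shows "(norm x)\<^sup>2 = (\<Sum>b\<in>Basis. (x \<bullet> b)\<^sup>2)"
  unfolding power2_norm_eq_inner by (subst euclidean_inner) (simp add: power2_eq_square)

lemma prod_normal_density: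
  fixes x :: "'a::euclidean_space" and s :: real
  assumes s: "s > 0"
  shows "(\<Prod>b\<in>Basis. ennreal (normal_density 0 s (x \<bullet> b))) =
    ennreal ((2 * pi * s\<^sup>2) powr (- real DIM('a) / 2) * exp (- (norm x)\<^sup>2 / (2 * s\<^sup>2)))"
proof -
  have "(\<Prod>b\<in>(Basis::'a set). normal_density 0 s (x \<bullet> b)) =
    (1 / sqrt (2 * pi * s\<^sup>2)) ^ DIM('a) * exp (\<Sum>b\<in>Basis. - (x \<bullet> b)\<^sup>2 / (2 * s\<^sup>2))"
    by (simp only: normal_density_def prod.distrib exp_sum[OF finite_Basis] diff_0_right prod_constant)
  also have "(\<Sum>b\<in>(Basis::'a set). - (x \<bullet> b)\<^sup>2 / (2 * s\<^sup>2)) = - (norm x)\<^sup>2 / (2 * s\<^sup>2)"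
    by (simp add: norm_sq_eq_sum_Basis sum_divide_distrib sum_negf)
  also have "(1 / sqrt (2 * pi * s\<^sup>2)) ^ DIM('a) = (2 * pi * s\<^sup>2) powr (- real DIM('a) / 2)"
  proof -
    have p: "2 * pi * s\<^sup>2 > 0" using s by simp
    then have "1 / sqrt (2 * pi * s\<^sup>2) = (2 * pi * s\<^sup>2) powr (- 1 / 2)"
      by (simp add: powr_minus_divide powr_half_sqrt)
    then have "(1 / sqrt (2 * pi * s\<^sup>2)) ^ DIM('a) = ((2 * pi * s\<^sup>2) powr (- 1 / 2)) powr real DIM('a)"
      using p by (subst powr_realpow) (auto simp del: powr_powr)
    then show ?thesis
      by (simp add: powr_powr)
  qed
  finally show ?thesis
    by (subst prod_ennreal) auto
qed

text \<open>Two widths are used: \<open>s = 1\<close> makes \<open>mu0\<close> a probability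
  measure, and \<open>s = sqrt 2\<close> supplies the integrable majorant in
  \<open>integrable_exp_norm\<close>.\<close>

lemma nn_integral_gaussian:
  fixes s :: real
  assumes s: "s > 0"
  shows "(\<integral>\<^sup>+x.
    ennreal ((2 * pi * s\<^sup>2) powr (- real DIM('a) / 2) * exp (- (norm x)\<^sup>2 / (2 * s\<^sup>2))) \<partial>(lborel :: 'a::euclidean_space measure)) = 1"
  using nn_integral_normal_density_prod[OF s] unfolding prod_normal_density[OF s] .

abbreviation gauss_density :: "'a::euclidean_space \<Rightarrow> real" where
  "gauss_density x \<equiv> (2 * pi) powr (- real DIM('a) / 2) * exp (- (norm x)\<^sup>2 / 2)"

lemma sets_mu0[simp, measurable_cong]: "sets mu0 = sets borel"
  and space_mu0[simp]: "space mu0 = UNIV"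
  by (simp_all add: mu0_def)

lemma prob_space_mu0: "prob_space (mu0 :: 'a::euclidean_space measure)"
  using nn_integral_gaussian[of 1, where 'a='a]
  by (intro prob_spaceI) (simp add: mu0_def emeasure_density)

interpretation mu0: prob_space "mu0 :: 'a::euclidean_space measure"
  by (rule prob_space_mu0)

lemma measure_mu0_UNIV[simp]: "measure mu0 UNIV = 1"
  using mu0.prob_space by simp

lemma integrable_mu0:
  fixes f :: "'a::euclidean_space \<Rightarrow> real"
  assumes "f \<in> borel_measurable borel"
  shows "integrable mu0 f \<longleftrightarrow> integrable lborel (\<lambda>x. gauss_density x * f x)"
  unfolding mu0_def using assms by (subst integrable_density) auto

lemma integral_mu0:
  fixes f :: "'a::euclidean_space \<Rightarrow> real"
  assumes "f \<in> borel_measurable borel"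
  shows "integral\<^sup>L mu0 f = (\<integral>x. gauss_density x * f x \<partial>lborel)"
  unfolding mu0_def using assms by (subst integral_density) auto

text \<open>Half of the quadratic exponent absorbs the linear one: K|x| is at most K^2 + |x|^2/4,
  which leaves a Gaussian of variance 2.\<close>

lemma integrable_exp_norm:
  "integrable mu0 (\<lambda>x::'a::euclidean_space. exp (K * norm x))"
proof -
  define c1 :: real where "c1 = (2 * pi) powr (- real DIM('a) / 2)"
  define c2 :: real where "c2 = (2 * pi * (sqrt 2)\<^sup>2) powr (- real DIM('a) / 2)"
  have pos: "c1 > 0" "c2 > 0" by (simp_all add: c1_def c2_def)
  have "integrable lborel (\<lambda>x::'a. c2 * exp (- (norm x)\<^sup>2 / (2 * (sqrt 2)\<^sup>2)))"
    using nn_integral_gaussian[of "sqrt 2", where 'a='a] pos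
    by (intro integrableI_bounded) (auto simp: c2_def abs_mult)
  then have i: "integrable lborel (\<lambda>x::'a. c1 * exp (K\<^sup>2) / c2 * (c2 * exp (- (norm x)\<^sup>2 / 4)))"
    by (intro integrable_mult_right) simp
  have "integrable lborel (\<lambda>x::'a. c1 * exp (- (norm x)\<^sup>2 / 2) * exp (K * norm x))"
  proof (rule Bochner_Integration.integrable_bound[OF i])
    show "AE x in lborel. norm (c1 * exp (- (norm x)\<^sup>2 / 2) * exp (K * norm x))
       \<le> norm (c1 * exp (K\<^sup>2) / c2 * (c2 * exp (- (norm (x::'a))\<^sup>2 / 4)))"
    proof (rule AE_I2)
      fix x :: 'a
      have "0 \<le> (norm x / 2 - K)\<^sup>2" by simp
      then have "- (norm x)\<^sup>2 / 2 + K * norm x \<le> K\<^sup>2 + - (norm x)\<^sup>2 / 4"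
        by (simp add: power2_eq_square algebra_simps)
      then have "exp (- (norm x)\<^sup>2 / 2) * exp (K * norm x) \<le> exp (K\<^sup>2) * exp (- (norm x)\<^sup>2 / 4)"
        by (simp flip: exp_add)
      then show "norm (c1 * exp (- (norm x)\<^sup>2 / 2) * exp (K * norm x))
       \<le> norm (c1 * exp (K\<^sup>2) / c2 * (c2 * exp (- (norm x)\<^sup>2 / 4)))"
        using pos by (simp add: abs_mult mult.assoc)
    qed
  qed measurable
  then show ?thesis
    by (subst integrable_mu0) (auto simp: c1_def)
qed

section \<open>Functions of at most exponential growth\<close>

text \<open>A class inside L^1 of \<open>mu0\<close> that contains bounded functions and polynomials
  and is stable under sums, products and powers. Integrability of a compound expression thereby
  becomes a matter of applying introduction rules.\<close>

definition exp_bounded :: "('a::real_normed_vector \<Rightarrow> real) \<Rightarrow> bool" where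
  "exp_bounded f \<longleftrightarrow> (\<exists>C K. C \<ge> 0 \<and> K \<ge> 0 \<and> (\<forall>x. \<bar>f x\<bar> \<le> C * exp (K * norm x)))"

lemma exp_bounded_bound:
  assumes "\<And>x. \<bar>f x\<bar> \<le> B"
  shows "exp_bounded f"
  unfolding exp_bounded_def
  by (rule exI[of _ "\<bar>B\<bar>"], rule exI[of _ 0]) (use assms in \<open>force intro: order_trans\<close>)

lemma exp_bounded_const[simp]: "exp_bounded (\<lambda>x. c)"
  by (rule exp_bounded_bound[of _ "\<bar>c\<bar>"]) auto

lemma exp_bounded_norm[simp]: "exp_bounded norm"
  unfolding exp_bounded_def
  by (rule exI[of _ 1], rule exI[of _ 1]) (auto intro: order_trans[OF _ exp_ge_add_one_self])

lemma exp_bounded_mult: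
  assumes "exp_bounded f" "exp_bounded g"
  shows "exp_bounded (\<lambda>x. f x * g x)"
proof -
  obtain C K D L where *: "C \<ge> 0" "K \<ge> 0" "\<And>x. \<bar>f x\<bar> \<le> C * exp (K * norm x)"
    "D \<ge> 0" "L \<ge> 0" "\<And>x. \<bar>g x\<bar> \<le> D * exp (L * norm x)"
    using assms unfolding exp_bounded_def by blast
  have "\<bar>f x * g x\<bar> \<le> (C * D) * exp ((K + L) * norm x)" for x
    using mult_mono[OF *(3)[of x] *(6)[of x]] * by (simp add: abs_mult algebra_simps exp_add)
  with * show ?thesis unfolding exp_bounded_def
    by (intro exI[of _ "C * D"] exI[of _ "K + L"]) auto
qed

lemma exp_bounded_add:
  assumes "exp_bounded f" "exp_bounded g"
  shows "exp_bounded (\<lambda>x. f x + g x)"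
proof -
  obtain C K D L where *: "C \<ge> 0" "K \<ge> 0" "\<And>x. \<bar>f x\<bar> \<le> C * exp (K * norm x)"
    "D \<ge> 0" "L \<ge> 0" "\<And>x. \<bar>g x\<bar> \<le> D * exp (L * norm x)"
    using assms unfolding exp_bounded_def by blast
  have "\<bar>f x + g x\<bar> \<le> (C + D) * exp ((K + L) * norm x)" for x
  proof -
    have "C * exp (K * norm x) \<le> C * exp ((K + L) * norm x)"
      "D * exp (L * norm x) \<le> D * exp ((K + L) * norm x)"
      using * by (auto intro!: mult_left_mono simp: distrib_right)
    then show ?thesis using *(3)[of x] *(6)[of x] by (simp add: distrib_right)
  qed
  with * show ?thesis unfolding exp_bounded_def
    by (intro exI[of _ "C + D"] exI[of _ "K + L"]) auto
qed

lemma exp_bounded_mono: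
  assumes "exp_bounded g" "\<And>x. \<bar>f x\<bar> \<le> \<bar>g x\<bar>"
  shows "exp_bounded f"
  using assms unfolding exp_bounded_def by (meson order_trans)

lemma exp_bounded_power: "exp_bounded f \<Longrightarrow> exp_bounded (\<lambda>x. f x ^ n)"
  by (induction n) (auto intro: exp_bounded_mult)

lemma exp_bounded_inner[simp]: "exp_bounded (\<lambda>x. x \<bullet> b)"
  by (rule exp_bounded_mono[OF exp_bounded_mult[OF exp_bounded_norm exp_bounded_const[of "norm b"]]])
    (simp add: Cauchy_Schwarz_ineq2)

lemma integrable_exp_bounded:
  assumes "exp_bounded f" and [measurable]: "f \<in> borel_measurable borel"
  shows "integrable mu0 f"
proof -
  obtain C K where *: "C \<ge> 0" "\<And>x. \<bar>f x\<bar> \<le> C * exp (K * norm x)"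
    using assms unfolding exp_bounded_def by blast
  show ?thesis
    by (rule Bochner_Integration.integrable_bound[of _ "\<lambda>x. C * exp (K * norm x)"])
      (use * in \<open>auto intro!: integrable_exp_norm simp: abs_mult\<close>)
qed

subsection \<open>Parameter integrals\<close>

lemma continuous_on_parameter_integral:
  fixes f :: "'b::{first_countable_topology,t2_space} \<Rightarrow> 'a \<Rightarrow> real"
  assumes cont: "\<And>x. x \<in> space M \<Longrightarrow> continuous_on S (\<lambda>t. f t x)"
    and meas: "\<And>t. t \<in> S \<Longrightarrow> f t \<in> borel_measurable M"
    and bound: "\<And>t x. t \<in> S \<Longrightarrow> x \<in> space M \<Longrightarrow> \<bar>f t x\<bar> \<le> w x"
    and w: "integrable M w"
  shows "continuous_on S (\<lambda>t. \<integral>x. f t x \<partial>M)"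
proof (rule continuous_on_sequentiallyI)
  fix X a assume X: "\<forall>n. X n \<in> S" "a \<in> S" "X \<longlonglongrightarrow> a"
  show "(\<lambda>n. \<integral>x. f (X n) x \<partial>M) \<longlonglongrightarrow> (\<integral>x. f a x \<partial>M)"
  proof (rule integral_dominated_convergence[OF _ _ w])
    show "AE x in M. (\<lambda>n. f (X n) x) \<longlonglongrightarrow> f a x"
      using cont X by (intro AE_I2) (auto simp: continuous_on_sequentially o_def)
  qed (use meas bound X in auto)
qed

text \<open>The mean value inequality on the convex set \<open>S\<close> bounds all difference
  quotients by \<open>w\<close>, so dominated convergence applies along every sequence tending to
  \<open>t0\<close>. Measurability of \<open>f' t0\<close> is a conclusion, which spares the callers
  a separate proof for each derivative.\<close>

lemma has_real_derivative_parameter_integral: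
  fixes f f' :: "real \<Rightarrow> 'a \<Rightarrow> real"
  assumes S: "open S" "convex S" "t0 \<in> S"
    and deriv: "\<And>t x. t \<in> S \<Longrightarrow> x \<in> space M \<Longrightarrow> ((\<lambda>t. f t x) has_real_derivative f' t x) (at t)"
    and int: "\<And>t. t \<in> S \<Longrightarrow> integrable M (f t)"
    and bound: "\<And>t x. t \<in> S \<Longrightarrow> x \<in> space M \<Longrightarrow> \<bar>f' t x\<bar> \<le> w x"
    and w: "integrable M w"
  shows "f' t0 \<in> borel_measurable M" (is ?meas)
    and "((\<lambda>t. \<integral>x. f t x \<partial>M) has_real_derivative (\<integral>x. f' t0 x \<partial>M)) (at t0)" (is ?der)
proof -
  let ?q = "\<lambda>t x. (f t x - f t0 x) / (t - t0)"
  have q_lim: "(\<lambda>n. ?q (X n) x) \<longlonglongrightarrow> f' t0 x"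
    if "\<forall>n. X n \<in> S - {t0}" "X \<longlonglongrightarrow> t0" "x \<in> space M" for X x
  proof -
    have "((\<lambda>t. ?q t x) \<longlongrightarrow> f' t0 x) (at t0 within S)"
      using has_field_derivative_at_within[OF deriv[OF S(3) that(3)]]
      by (simp add: has_field_derivative_iff)
    then show ?thesis using that by (auto simp: tendsto_at_iff_sequentially o_def)
  qed
  have q_meas: "?q t \<in> borel_measurable M" if "t \<in> S" for t
    using int[OF that] int[OF S(3)] by auto
  have q_bound: "\<bar>?q t x\<bar> \<le> w x" if "t \<in> S" "t \<noteq> t0" "x \<in> space M" for t x
  proof -
    have "norm (f t x - f t0 x) \<le> w x * norm (t - t0)"
      by (rule field_differentiable_bound[OF S(2), of "\<lambda>t. f t x" "\<lambda>t. f' t x"])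
        (use that S deriv bound in \<open>auto intro: has_field_derivative_at_within\<close>)
    then show ?thesis using that by (simp add: field_simps)
  qed
  obtain d where d: "d > 0" "ball t0 d \<subseteq> S"
    using S openE by blast
  \<comment> \<open>Any sequence in \<open>S - {t0}\<close> tending to \<open>t0\<close> would do;
    it exhibits \<open>f' t0\<close> as a pointwise limit of measurable quotients. The factor
    \<open>d / 2\<close> keeps it inside the ball.\<close>
  define Y where "Y n = t0 + d / 2 * inverse (real (Suc n))" for n
  have Y: "\<forall>n. Y n \<in> S - {t0}" "Y \<longlonglongrightarrow> t0"
  proof -
    show "\<forall>n. Y n \<in> S - {t0}"
    proof
      fix n
      have "d / 2 * inverse (real (Suc n)) \<le> d / 2 * 1"
        using d(1) by (intro mult_left_mono) (auto simp: field_simps)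
      then have "Y n \<in> ball t0 d" "Y n \<noteq> t0"
        using d(1) by (auto simp: Y_def dist_real_def)
      then show "Y n \<in> S - {t0}" using d by auto
    qed
    show "Y \<longlonglongrightarrow> t0"
      using tendsto_add[OF tendsto_const tendsto_mult_right_zero[OF LIMSEQ_inverse_real_of_nat], of t0 "d / 2"]
      by (simp add: Y_def[abs_def])
  qed
  show meas: ?meas
    by (rule borel_measurable_LIMSEQ_real[of M "\<lambda>n. ?q (Y n)"])
      (use q_lim[OF Y] q_meas Y in auto)
  show ?der
    unfolding has_field_derivative_iff
    unfolding at_within_open[OF S(3) S(1), symmetric] tendsto_at_iff_sequentially o_def
  proof (intro allI impI)
    fix X assume X: "\<forall>i. X i \<in> S - {t0}" "X \<longlonglongrightarrow> t0"
    have "(\<lambda>n. \<integral>x. ?q (X n) x \<partial>M) \<longlonglongrightarrow> (\<integral>x. f' t0 x \<partial>M)"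
      by (rule integral_dominated_convergence[OF meas _ w])
        (use X q_meas q_bound q_lim[OF X] in auto)
    moreover have "(\<integral>x. ?q (X n) x \<partial>M) = ((\<integral>x. f (X n) x \<partial>M) - (\<integral>x. f t0 x \<partial>M)) / (X n - t0)" for n
    proof -
      have "integrable M (f (X n))" "integrable M (f t0)"
        using X int S by auto
      then show ?thesis by simp
    qed
    ultimately show "(\<lambda>n. ((\<integral>x. f (X n) x \<partial>M) - (\<integral>x. f t0 x \<partial>M)) / (X n - t0)) \<longlonglongrightarrow> (\<integral>x. f' t0 x \<partial>M)"
      by (simp only:)
  qed
qed

subsection \<open>Gaussian integration by parts\<close>

text \<open>This is the Cameron-Martin formula: Lebesgue measure is translation invariant, and the
  exponential is the ratio of the shifted density to the original one.\<close>

lemma integral_mu0_translate: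
  fixes F :: "'a::euclidean_space \<Rightarrow> real"
  assumes [measurable]: "F \<in> borel_measurable borel"
  shows "(\<integral>x. F (x + a) \<partial>mu0) = (\<integral>x. F x * exp (x \<bullet> a - (norm a)\<^sup>2 / 2) \<partial>mu0)"
proof -
  have "(\<integral>x. F (x + a) \<partial>mu0) = (\<integral>x. gauss_density x * F (x + a) \<partial>lborel)"
    by (rule integral_mu0) simp
  also have "\<dots> = (\<integral>x. gauss_density ((x + a) - a) * F (x + a) \<partial>lborel)" by simp
  also have "\<dots> = (\<integral>x. gauss_density (x - a) * F x \<partial>(distr lborel borel (\<lambda>x. x + a)))"
    by (subst integral_distr) auto
  also have "distr lborel borel (\<lambda>x. x + a) = (lborel :: 'a measure)"
    using lborel_distr_plus[of a] by (simp add: add.commute[of _ a])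
  also have "(\<integral>x. gauss_density (x - a) * F x \<partial>lborel)
      = (\<integral>x. gauss_density x * (F x * exp (x \<bullet> a - (norm a)\<^sup>2 / 2)) \<partial>lborel)"
  proof (rule Bochner_Integration.integral_cong)
    fix x :: 'a
    have "- (norm (x - a))\<^sup>2 / 2 = - (norm x)\<^sup>2 / 2 + (x \<bullet> a - (norm a)\<^sup>2 / 2)"
      by (simp add: power2_norm_eq_inner inner_diff_left inner_diff_right inner_commute field_simps)
    then show "gauss_density (x - a) * F x = gauss_density x * (F x * exp (x \<bullet> a - (norm a)\<^sup>2 / 2))"
      by (simp only: exp_add mult_ac)
  qed simp
  also have "\<dots> = (\<integral>x. F x * exp (x \<bullet> a - (norm a)\<^sup>2 / 2) \<partial>mu0)"
    by (rule integral_mu0[symmetric]) simp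
  finally show ?thesis .
qed

text \<open>The bound is uniform over \<open>\<bar>t\<bar> \<le> 1\<close>, so it can dominate a
  whole family of translates when differentiating in t. A unit shift costs the factor exp K.\<close>

lemma exp_bounded_translate:
  assumes "exp_bounded F" "norm e \<le> 1"
  obtains C K where "C \<ge> 0" "K \<ge> 0" "\<And>t x. \<bar>t\<bar> \<le> 1 \<Longrightarrow> \<bar>F (x + t *\<^sub>R e)\<bar> \<le> C * exp (K * norm x)"
proof -
  obtain C K where *: "C \<ge> 0" "K \<ge> 0" "\<And>x. \<bar>F x\<bar> \<le> C * exp (K * norm x)"
    using assms unfolding exp_bounded_def by blast
  have "\<bar>F (x + t *\<^sub>R e)\<bar> \<le> (C * exp K) * exp (K * norm x)" if "\<bar>t\<bar> \<le> 1" for t x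
  proof -
    have "norm (x + t *\<^sub>R e) \<le> norm x + 1"
      using norm_triangle_ineq[of x "t *\<^sub>R e"] mult_mono[OF that assms(2)] by simp
    then have "C * exp (K * norm (x + t *\<^sub>R e)) \<le> C * exp (K * (norm x + 1))"
      using * by (intro mult_left_mono iffD2[OF exp_le_cancel_iff]) auto
    then show ?thesis using *(3)[of "x + t *\<^sub>R e"] by (simp add: distrib_left exp_add mult_ac)
  qed
  with * that show ?thesis by (meson exp_ge_zero mult_nonneg_nonneg)
qed

text \<open>Obtained by differentiating the translation formula at 0.\<close>

lemma gaussian_integration_by_parts:
  fixes F D :: "'a::euclidean_space \<Rightarrow> real"
  assumes e: "norm e = 1"
    and F[measurable]: "F \<in> borel_measurable borel"
    and bF: "exp_bounded F" and bD: "exp_bounded D"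
    and der: "\<And>x. ((\<lambda>t. F (x + t *\<^sub>R e)) has_real_derivative D x) (at 0)"
  shows "(\<integral>x. (x \<bullet> e) * F x \<partial>mu0) = (\<integral>x. D x \<partial>mu0)"
proof -
  \<comment> \<open>The hypothesis gives the derivative only at t = 0, but at every base point;
    moving the base point along the line gives it at every t.\<close>
  have der': "((\<lambda>t. F (x + t *\<^sub>R e)) has_real_derivative D (x + t *\<^sub>R e)) (at t)" for x t
    using DERIV_shift[of "\<lambda>t. F (x + t *\<^sub>R e)" "D (x + t *\<^sub>R e)" 0 t] der[of "x + t *\<^sub>R e"]
    by (simp add: algebra_simps)
  let ?S = "{-1<..<1} :: real set"
  obtain C K where CK: "C \<ge> 0" "K \<ge> 0" "\<And>t x. \<bar>t\<bar> \<le> 1 \<Longrightarrow> \<bar>F (x + t *\<^sub>R e)\<bar> \<le> C * exp (K * norm x)"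
    using exp_bounded_translate[OF bF, of e] e by auto
  obtain C' K' where CK': "C' \<ge> 0" "K' \<ge> 0" "\<And>t x. \<bar>t\<bar> \<le> 1 \<Longrightarrow> \<bar>D (x + t *\<^sub>R e)\<bar> \<le> C' * exp (K' * norm x)"
    using exp_bounded_translate[OF bD, of e] e by auto
  have L: "((\<lambda>t. \<integral>x. F (x + t *\<^sub>R e) \<partial>mu0) has_real_derivative (\<integral>x. D (x + 0 *\<^sub>R e) \<partial>mu0)) (at 0)"
  proof (rule has_real_derivative_parameter_integral(2)[of ?S])
    show "integrable mu0 (\<lambda>x. C' * exp (K' * norm (x::'a)))"
      using integrable_exp_norm by auto
    show "integrable mu0 (\<lambda>x. F (x + t *\<^sub>R e))" if "t \<in> ?S" for t
      by (rule Bochner_Integration.integrable_bound[of _ "\<lambda>x. C * exp (K * norm x)"])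
        (use CK that in \<open>auto intro!: integrable_exp_norm simp: abs_mult\<close>)
  qed (use CK' der' in auto)
  let ?g = "\<lambda>t x. F x * exp (t * (x \<bullet> e) - t\<^sup>2 / 2)"
  let ?g' = "\<lambda>t x. F x * (exp (t * (x \<bullet> e) - t\<^sup>2 / 2) * (x \<bullet> e - t))"
  have xe: "\<bar>x \<bullet> e\<bar> \<le> norm x" for x
    using Cauchy_Schwarz_ineq2[of x e] e by simp
  have expo: "exp (t * (x \<bullet> e) - t\<^sup>2 / 2) \<le> exp (norm x)" if "\<bar>t\<bar> \<le> 1" for t x
  proof -
    have "t * (x \<bullet> e) \<le> norm x"
      using mult_mono[OF that xe[of x]] abs_ge_self[of "t * (x \<bullet> e)"] by (simp add: abs_mult)
    moreover have "0 \<le> t\<^sup>2" by simp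
    ultimately show ?thesis by (subst exp_le_cancel_iff) linarith
  qed
  have F0: "\<bar>F x\<bar> \<le> C * exp (K * norm x)" for x using CK(3)[of 0 x] by simp
  have R: "((\<lambda>t. \<integral>x. ?g t x \<partial>mu0) has_real_derivative (\<integral>x. ?g' 0 x \<partial>mu0)) (at 0)"
  proof (rule has_real_derivative_parameter_integral(2)[of ?S])
    \<comment> \<open>The increase of K by 2 comes from two factors of size exp |x|: the
      Cameron-Martin exponential for \<open>\<bar>t\<bar> \<le> 1\<close>, and
      \<open>x \<bullet> e - t\<close>, which is at most |x| + 1 in absolute value.\<close>
    show "integrable mu0 (\<lambda>x. C * exp ((K + 2) * norm (x::'a)))"
      using integrable_exp_norm by auto
    show "integrable mu0 (?g t)" if "t \<in> ?S" for t
    proof (rule Bochner_Integration.integrable_bound[of _ "\<lambda>x. C * exp ((K + 1) * norm x)"])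
      show "AE x in mu0. norm (?g t x) \<le> norm (C * exp ((K + 1) * norm x))"
      proof (rule AE_I2)
        fix x :: 'a
        have "\<bar>F x\<bar> * exp (t * (x \<bullet> e) - t\<^sup>2 / 2) \<le> (C * exp (K * norm x)) * exp (norm x)"
          using that CK F0 expo[of t x] by (intro mult_mono) auto
        then show "norm (?g t x) \<le> norm (C * exp ((K + 1) * norm x))"
          using CK(1) by (simp add: abs_mult distrib_right exp_add mult.assoc)
      qed
    qed (auto intro: integrable_exp_norm)
    show "\<bar>?g' t x\<bar> \<le> C * exp ((K + 2) * norm x)" if "t \<in> ?S" for t x
    proof -
      have "\<bar>x \<bullet> e - t\<bar> \<le> exp (norm x)"
        using xe[of x] that exp_ge_add_one_self[of "norm x"]
        unfolding abs_le_iff greaterThanLessThan_iff by linarith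
      then have "\<bar>F x\<bar> * (exp (t * (x \<bullet> e) - t\<^sup>2 / 2) * \<bar>x \<bullet> e - t\<bar>) \<le> (C * exp (K * norm x)) * (exp (norm x) * exp (norm x))"
        using expo[of t x] that F0[of x] CK by (intro mult_mono) auto
      also have "\<dots> = C * exp ((K + 2) * norm x)"
        by (simp add: algebra_simps flip: exp_add)
      finally show ?thesis by (simp add: abs_mult)
    qed
    show "((\<lambda>t. ?g t x) has_real_derivative ?g' t x) (at t)" for t x
      by (auto intro!: derivative_eq_intros)
  qed auto
  have "(\<integral>x. F (x + t *\<^sub>R e) \<partial>mu0) = (\<integral>x. ?g t x \<partial>mu0)" for t
    using integral_mu0_translate[OF F, of "t *\<^sub>R e"] e by (simp add: power_mult_distrib)
  with L R have "(\<integral>x. D x \<partial>mu0) = (\<integral>x. ?g' 0 x \<partial>mu0)"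
    by (auto intro: DERIV_unique)
  then show ?thesis by (simp add: mult.commute)
qed

subsection \<open>Smooth functions with compact support\<close>

text \<open>Written with \<open>frechet_derivative\<close> so that it depends on \<open>g\<close>
  alone and can be iterated; members of \<open>Cc_inf\<close> are differentiable everywhere, so the
  choice operator is harmless there.\<close>

definition partial_deriv :: "'a::euclidean_space \<Rightarrow> ('a \<Rightarrow> real) \<Rightarrow> 'a \<Rightarrow> real" where
  "partial_deriv e g x = frechet_derivative g (at x) e"

lemma Cc_inf_differentiable:
  assumes "g \<in> Cc_inf"
  shows "g differentiable (at x)"
  using assms unfolding Cc_inf_def smooth_fun_def differentiable_def by blast

text \<open>The family that witnesses smoothness of \<open>g\<close> also witnesses it for the
  derivative, and the support cannot grow because \<open>g\<close> vanishes on the open complement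
  of its support. This closure is what allows the energy identity to be applied repeatedly.\<close>

lemma Cc_inf_partial_deriv:
  assumes g: "g \<in> Cc_inf" and i: "i \<in> Basis"
  shows "partial_deriv i g \<in> Cc_inf"
proof -
  obtain F where F: "g \<in> F" "\<forall>g\<in>F. continuous_on UNIV g \<and>
      (\<exists>g'. (\<forall>x. (g has_derivative g' x) (at x)) \<and> (\<forall>i\<in>Basis. (\<lambda>x. g' x i) \<in> F))"
    using g unfolding Cc_inf_def smooth_fun_def by blast
  then obtain g' where g': "\<And>x. (g has_derivative g' x) (at x)" "\<And>i. i \<in> Basis \<Longrightarrow> (\<lambda>x. g' x i) \<in> F"
    by blast
  have fd: "frechet_derivative g (at x) = g' x" for x
    using frechet_derivative_at[OF g'(1)] by simp
  then have eq: "partial_deriv i g = (\<lambda>x. g' x i)"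
    by (simp add: partial_deriv_def fun_eq_iff)
  have "smooth_fun (partial_deriv i g)"
    unfolding smooth_fun_def using F g'(2)[OF i] by (auto simp: eq)
  moreover have "closure {x. partial_deriv i g x \<noteq> 0} \<subseteq> closure {x. g x \<noteq> 0}"
  proof (rule closure_minimal)
    show "{x. partial_deriv i g x \<noteq> 0} \<subseteq> closure {x. g x \<noteq> 0}"
    proof (rule subsetI, rule ccontr)
      fix x assume x: "x \<in> {x. partial_deriv i g x \<noteq> 0}" "x \<notin> closure {x. g x \<noteq> 0}"
      have "(g has_derivative (\<lambda>h. 0)) (at x)"
      proof (rule has_derivative_transform_within_open[OF has_derivative_const])
        show "open (- closure {x. g x \<noteq> 0})" by (rule open_Compl[OF closed_closure])
        show "x \<in> - closure {x. g x \<noteq> 0}" using x by simp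
        show "0 = g y" if "y \<in> - closure {x. g x \<noteq> 0}" for y
          using that closure_subset[of "{x. g x \<noteq> 0}"] by auto
      qed
      then have "g' x = (\<lambda>h. 0)" using frechet_derivative_at fd by metis
      then show False using x by (simp add: eq)
    qed
  qed simp
  moreover have "compact (closure {x. g x \<noteq> 0})"
    using g by (simp add: Cc_inf_def)
  ultimately show ?thesis
    unfolding Cc_inf_def using compact_Int_closed[OF _ closed_closure, of "closure {x. g x \<noteq> 0}" "{x. partial_deriv i g x \<noteq> 0}"]
    by (simp add: inf.absorb2)
qed

lemma Cc_inf_continuous: "g \<in> Cc_inf \<Longrightarrow> continuous_on S g"
  using Cc_inf_differentiable differentiable_imp_continuous_within
  by (metis continuous_at_imp_continuous_on)

lemma Cc_inf_measurable: "g \<in> Cc_inf \<Longrightarrow> g \<in> borel_measurable borel"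
  using Cc_inf_continuous[of g UNIV] borel_measurable_continuous_onI by blast

lemma Cc_inf_bounded:
  assumes "g \<in> Cc_inf"
  obtains B where "\<And>x. \<bar>g x\<bar> \<le> B" "B \<ge> 0"
proof -
  let ?K = "closure {x. g x \<noteq> 0}"
  have "bounded (g ` ?K)"
    using assms Cc_inf_continuous[OF assms] unfolding Cc_inf_def
    by (intro compact_imp_bounded compact_continuous_image) auto
  then obtain B where B: "\<And>x. x \<in> ?K \<Longrightarrow> \<bar>g x\<bar> \<le> B" by (auto simp: bounded_iff)
  have "\<bar>g x\<bar> \<le> \<bar>B\<bar>" for x
    using B[of x] closure_subset[of "{x. g x \<noteq> 0}"] by (cases "g x = 0") force+
  then show ?thesis using that[of "\<bar>B\<bar>"] by auto
qed

lemma Cc_inf_has_derivative: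
  assumes "g \<in> Cc_inf"
  shows "(g has_derivative (\<lambda>h. \<Sum>i\<in>Basis. (h \<bullet> i) * partial_deriv i g x)) (at x)"
proof -
  let ?D = "frechet_derivative g (at x)"
  have D: "(g has_derivative ?D) (at x)"
    using Cc_inf_differentiable[OF assms] frechet_derivative_works by blast
  then have lin: "linear ?D" by (rule has_derivative_linear)
  have "?D h = (\<Sum>i\<in>Basis. (h \<bullet> i) * partial_deriv i g x)" for h
    unfolding partial_deriv_def
    by (subst euclidean_representation[symmetric, of h])
      (simp only: linear_sum[OF lin] linear_scale[OF lin] real_scaleR_def)
  then have "?D = (\<lambda>h. \<Sum>i\<in>Basis. (h \<bullet> i) * partial_deriv i g x)"
    by (rule ext)
  with D show ?thesis by (simp only:)
qed

lemma sum_scaled_Basis: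
  fixes f :: "'a::euclidean_space \<Rightarrow> real"
  assumes "i \<in> Basis"
  shows "(\<Sum>j\<in>Basis. ((s *\<^sub>R i) \<bullet> j) * f j) = s * f i"
proof -
  have "(\<Sum>j\<in>Basis. ((s *\<^sub>R i) \<bullet> j) * f j) = (\<Sum>j\<in>Basis. if j = i then s * f j else 0)"
    using assms by (intro sum.cong refl) (auto simp: inner_Basis)
  then show ?thesis using assms by simp
qed

lemma Cc_inf_chain:
  assumes "g \<in> Cc_inf" "(c has_vector_derivative v) (at t)"
  shows "((\<lambda>t. g (c t)) has_real_derivative (\<Sum>i\<in>Basis. (v \<bullet> i) * partial_deriv i g (c t))) (at t)"
proof -
  have "(g \<circ> c has_derivative (\<lambda>h. \<Sum>i\<in>Basis. (h \<bullet> i) * partial_deriv i g (c t)) \<circ> (\<lambda>h. h *\<^sub>R v)) (at t)"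
    using assms(2) Cc_inf_has_derivative[OF assms(1)]
    by (intro diff_chain_at) (auto simp: has_vector_derivative_def)
  moreover have "(\<lambda>h. \<Sum>i\<in>Basis. (h \<bullet> i) * partial_deriv i g (c t)) \<circ> (\<lambda>h. h *\<^sub>R v)
    = (*) (\<Sum>i\<in>Basis. (v \<bullet> i) * partial_deriv i g (c t))"
    by (simp add: fun_eq_iff sum_distrib_left mult_ac)
  ultimately show ?thesis
    by (simp only: has_field_derivative_def o_def)
qed

subsection \<open>The Mehler semigroup\<close>

text \<open>This is the Ornstein-Uhlenbeck semigroup at time t with r = exp (- 2 t).\<close>

definition mehler :: "real \<Rightarrow> ('a::euclidean_space \<Rightarrow> real) \<Rightarrow> 'a \<Rightarrow> real" where
  "mehler r g x = (\<integral>z. g (sqrt r *\<^sub>R x + sqrt (1 - r) *\<^sub>R z) \<partial>mu0)"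

lemma integrable_Cc_inf:
  assumes "g \<in> Cc_inf" and [measurable]: "h \<in> borel_measurable borel"
  shows "integrable mu0 (\<lambda>z. g (h z))"
proof -
  obtain B where B: "\<And>x. \<bar>g x\<bar> \<le> B" using Cc_inf_bounded[OF assms(1)] by metis
  note [measurable] = Cc_inf_measurable[OF assms(1)]
  show ?thesis
    using B by (intro integrable_exp_bounded exp_bounded_bound[of _ B]) auto
qed

text \<open>Averaging against a probability measure does not enlarge a sup bound. Uniformity in
  \<open>r\<close> and \<open>x\<close> provides the dominating functions below.\<close>

lemma mehler_bound:
  assumes "g \<in> Cc_inf" "\<And>x. \<bar>g x\<bar> \<le> B"
  shows "\<bar>mehler r g x\<bar> \<le> B"
proof -
  have "\<bar>mehler r g x\<bar> \<le> (\<integral>z. \<bar>g (sqrt r *\<^sub>R x + sqrt (1 - r) *\<^sub>R z)\<bar> \<partial>mu0)"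
    unfolding mehler_def by (rule integral_abs_bound)
  also have "\<dots> \<le> (\<integral>z. B \<partial>(mu0 :: 'a measure))"
  proof (rule integral_mono)
    show "integrable mu0 (\<lambda>z. \<bar>g (sqrt r *\<^sub>R x + sqrt (1 - r) *\<^sub>R z)\<bar>)"
      by (rule integrable_abs[OF integrable_Cc_inf[OF assms(1)]]) simp
  qed (use assms in auto)
  also have "\<dots> = B" by simp
  finally show ?thesis .
qed

lemma mehler_measurable[measurable (raw)]:
  assumes g: "g \<in> Cc_inf"
  shows "mehler r g \<in> borel_measurable borel"
proof -
  note [measurable] = Cc_inf_measurable[OF g]
  show ?thesis
    unfolding mehler_def[abs_def] by (rule mu0.borel_measurable_lebesgue_integral) measurable
qed

lemma mehler_exp_bounded:
  assumes "g \<in> Cc_inf"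
  shows "exp_bounded (mehler r g)"
proof -
  obtain B where B: "\<And>x. \<bar>g x\<bar> \<le> B" using Cc_inf_bounded[OF assms(1)] by metis
  show ?thesis
    using mehler_bound[OF assms B] by (intro exp_bounded_bound) auto
qed

text \<open>The commutation of a partial derivative with the semigroup; \<open>sqrt r\<close> is the
  coefficient of \<open>x\<close> inside the integrand.\<close>

lemma mehler_directional_derivative:
  assumes g: "g \<in> Cc_inf" and i: "i \<in> Basis" and r: "0 \<le> r"
  shows "((\<lambda>t. mehler r g (x + t *\<^sub>R i)) has_real_derivative sqrt r * mehler r (partial_deriv i g) x) (at 0)"
proof -
  note di = Cc_inf_partial_deriv[OF g i]
  obtain B where B: "\<And>x. \<bar>partial_deriv i g x\<bar> \<le> B" "B \<ge> 0"
    using Cc_inf_bounded[OF di] by metis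
  let ?c = "\<lambda>t z. sqrt r *\<^sub>R (x + t *\<^sub>R i) + sqrt (1 - r) *\<^sub>R z"
  have "((\<lambda>t. \<integral>z. g (?c t z) \<partial>mu0) has_real_derivative
      (\<integral>z. sqrt r * partial_deriv i g (?c 0 z) \<partial>mu0)) (at 0)"
  proof (rule has_real_derivative_parameter_integral(2)[of UNIV])
    show "((\<lambda>t. g (?c t z)) has_real_derivative sqrt r * partial_deriv i g (?c t z)) (at t)" for t z
    proof -
      have "((\<lambda>t. ?c t z) has_vector_derivative sqrt r *\<^sub>R i) (at t)"
        unfolding has_vector_derivative_def by (auto intro!: derivative_eq_intros)
      from Cc_inf_chain[OF g this] show ?thesis
        using i by (simp only: sum_scaled_Basis)
    qed
    show "integrable mu0 (\<lambda>z::'a. sqrt r * B)" by simp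
    show "integrable mu0 (\<lambda>z. g (?c t z))" for t
      using g by (intro integrable_Cc_inf) auto
    show "\<bar>sqrt r * partial_deriv i g (?c t z)\<bar> \<le> sqrt r * B" for t z
      using B r by (simp add: abs_mult mult_left_mono)
  qed auto
  then show ?thesis by (simp add: mehler_def)
qed

text \<open>Differentiating the path gives x / (2 sqrt r) - z / (2 sqrt (1 - r)). Integration by
  parts in z trades the factor z for another derivative of \<open>g\<close> and a factor sqrt (1 -
  r), which removes the singularity at r = 1.\<close>

lemma mehler_time_derivative:
  assumes g: "g \<in> Cc_inf" and r: "0 < r" "r < 1"
  shows "((\<lambda>r. mehler r g x) has_real_derivative
    (\<Sum>i\<in>Basis. (x \<bullet> i) / (2 * sqrt r) * mehler r (partial_deriv i g) x
       - 1 / 2 * mehler r (partial_deriv i (partial_deriv i g)) x)) (at r)"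
proof -
  note di = Cc_inf_partial_deriv[OF g]
  note dii = Cc_inf_partial_deriv[OF di]
  have "\<forall>i\<in>Basis. \<exists>B. \<forall>x. \<bar>partial_deriv i g x\<bar> \<le> B \<and> B \<ge> 0"
    using Cc_inf_bounded[OF di] by metis
  then obtain B where B: "\<And>i x. i \<in> Basis \<Longrightarrow> \<bar>partial_deriv i g x\<bar> \<le> B i"
      "\<And>i. i \<in> Basis \<Longrightarrow> B i \<ge> 0"
    by metis
  let ?c = "\<lambda>t z. sqrt t *\<^sub>R x + sqrt (1 - t) *\<^sub>R z"
  let ?v = "\<lambda>t z. (inverse (sqrt t) / 2) *\<^sub>R x - (inverse (sqrt (1 - t)) / 2) *\<^sub>R z"
  let ?f' = "\<lambda>t z. \<Sum>i\<in>Basis. (?v t z \<bullet> i) * partial_deriv i g (?c t z)"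
  let ?w = "\<lambda>z::'a. \<Sum>i\<in>Basis. (inverse (sqrt (r / 2)) / 2 * norm x + inverse (sqrt ((1 - r) / 2)) / 2 * norm z) * B i"
  \<comment> \<open>The end points are the midpoints between r and 0 and between r and 1, so both
    inverse square roots stay bounded on this interval by their values at its ends.\<close>
  let ?S = "{r / 2<..<(1 + r) / 2}"
  have S: "0 < t" "t < 1" "inverse (sqrt t) \<le> inverse (sqrt (r / 2))"
    "inverse (sqrt (1 - t)) \<le> inverse (sqrt ((1 - r) / 2))" if "t \<in> ?S" for t
    using that r by (auto intro!: le_imp_inverse_le)
  have "((\<lambda>t. \<integral>z. g (?c t z) \<partial>mu0) has_real_derivative (\<integral>z. ?f' r z \<partial>mu0)) (at r)"
  proof (rule has_real_derivative_parameter_integral(2)[of ?S])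
    show "((\<lambda>t. g (?c t z)) has_real_derivative ?f' t z) (at t)" if "t \<in> ?S" for t z
    proof -
      have "((\<lambda>t. ?c t z) has_vector_derivative ?v t z) (at t)"
      proof -
        have "(sqrt has_real_derivative inverse (sqrt t) / 2) (at t)"
          "((\<lambda>t. sqrt (1 - t)) has_real_derivative - (inverse (sqrt (1 - t)) / 2)) (at t)"
          using S(1,2)[OF that] by (auto intro!: derivative_eq_intros)
        from has_vector_derivative_add[OF has_vector_derivative_scaleR[OF this(1) has_vector_derivative_const[of x]]
            has_vector_derivative_scaleR[OF this(2) has_vector_derivative_const[of z]]]
        show ?thesis by simp
      qed
      from Cc_inf_chain[OF g this] show ?thesis .
    qed
    show "integrable mu0 (\<lambda>z. g (?c t z))" for t
      using g by (intro integrable_Cc_inf) auto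
    show "\<bar>?f' t z\<bar> \<le> ?w z" if "t \<in> ?S" for t z
    proof (rule order_trans[OF sum_abs], rule sum_mono)
      fix i :: 'a assume i: "i \<in> Basis"
      have "\<bar>?v t z \<bullet> i\<bar> \<le> norm (?v t z)" using i by (rule Basis_le_norm)
      also have "\<dots> \<le> norm ((inverse (sqrt t) / 2) *\<^sub>R x) + norm ((inverse (sqrt (1 - t)) / 2) *\<^sub>R z)"
        by (rule norm_triangle_ineq4)
      also have "\<dots> \<le> inverse (sqrt (r / 2)) / 2 * norm x + inverse (sqrt ((1 - r) / 2)) / 2 * norm z"
        unfolding norm_scaleR using S[OF that]
        by (intro add_mono mult_right_mono) auto
      finally show "\<bar>(?v t z \<bullet> i) * partial_deriv i g (?c t z)\<bar> \<le>
         (inverse (sqrt (r / 2)) / 2 * norm x + inverse (sqrt ((1 - r) / 2)) / 2 * norm z) * B i"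
        unfolding abs_mult using B i by (intro mult_mono) auto
    qed
    show "integrable mu0 ?w"
      by (intro Bochner_Integration.integrable_sum integrable_exp_bounded exp_bounded_mult exp_bounded_add) auto
  qed (use r in auto)
  moreover have "(\<integral>z. ?f' r z \<partial>mu0) = (\<Sum>i\<in>Basis. (x \<bullet> i) / (2 * sqrt r) * mehler r (partial_deriv i g) x
       - 1 / 2 * mehler r (partial_deriv i (partial_deriv i g)) x)"
  proof -
    have *: "integrable mu0 (\<lambda>z. partial_deriv i g (?c r z))"
      "integrable mu0 (\<lambda>z. (z \<bullet> i) * partial_deriv i g (?c r z))" if "i \<in> Basis" for i
    proof -
      note [measurable] = Cc_inf_measurable[OF di[OF that]]
      show "integrable mu0 (\<lambda>z. partial_deriv i g (?c r z))"
        using di[OF that] by (intro integrable_Cc_inf) auto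
      show "integrable mu0 (\<lambda>z. (z \<bullet> i) * partial_deriv i g (?c r z))"
        using B(1)[OF that] by (intro integrable_exp_bounded exp_bounded_mult exp_bounded_bound[of "\<lambda>z. partial_deriv i g (?c r z)"]) auto
    qed
    have ibp: "(\<integral>z. (z \<bullet> i) * partial_deriv i g (?c r z) \<partial>mu0)
        = sqrt (1 - r) * mehler r (partial_deriv i (partial_deriv i g)) x" if i: "i \<in> Basis" for i
    proof -
      note [measurable] = Cc_inf_measurable[OF di[OF i]]
      obtain C where C: "\<And>x. \<bar>partial_deriv i (partial_deriv i g) x\<bar> \<le> C"
        using Cc_inf_bounded[OF dii[OF i i]] by metis
      have "(\<integral>z. (z \<bullet> i) * partial_deriv i g (?c r z) \<partial>mu0)
        = (\<integral>z. sqrt (1 - r) * partial_deriv i (partial_deriv i g) (?c r z) \<partial>mu0)"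
      proof (rule gaussian_integration_by_parts)
        show "((\<lambda>t. partial_deriv i g (?c r (z + t *\<^sub>R i))) has_real_derivative
            sqrt (1 - r) * partial_deriv i (partial_deriv i g) (?c r z)) (at 0)" for z
        proof -
          have "((\<lambda>t. ?c r (z + t *\<^sub>R i)) has_vector_derivative sqrt (1 - r) *\<^sub>R i) (at 0)"
            unfolding has_vector_derivative_def by (auto intro!: derivative_eq_intros)
          from Cc_inf_chain[OF di[OF i] this, unfolded scaleR_zero_left add_0_right] show ?thesis
            using i by (simp only: sum_scaled_Basis)
        qed
        show "exp_bounded (\<lambda>z. partial_deriv i g (?c r z))"
          using B(1)[OF i] by (intro exp_bounded_bound) auto
        show "exp_bounded (\<lambda>z. sqrt (1 - r) * partial_deriv i (partial_deriv i g) (?c r z))"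
          using C by (intro exp_bounded_mult exp_bounded_const exp_bounded_bound[of "\<lambda>z. partial_deriv i (partial_deriv i g) (?c r z)"]) auto
      qed (use i in auto)
      then show ?thesis by (simp add: mehler_def)
    qed
    have "(\<integral>z. ?f' r z \<partial>mu0) = (\<integral>z. (\<Sum>i\<in>Basis. (x \<bullet> i) / (2 * sqrt r) * partial_deriv i g (?c r z)
        - 1 / (2 * sqrt (1 - r)) * ((z \<bullet> i) * partial_deriv i g (?c r z))) \<partial>mu0)"
      by (intro Bochner_Integration.integral_cong sum.cong refl) (simp add: inner_diff_left left_diff_distrib inverse_eq_divide)
    also have "\<dots> = (\<Sum>i\<in>Basis. (x \<bullet> i) / (2 * sqrt r) * mehler r (partial_deriv i g) x
        - 1 / (2 * sqrt (1 - r)) * (\<integral>z. (z \<bullet> i) * partial_deriv i g (?c r z) \<partial>mu0))"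
      using * by (subst Bochner_Integration.integral_sum) (auto intro!: sum.cong simp: mehler_def)
    also have "\<dots> = (\<Sum>i\<in>Basis. (x \<bullet> i) / (2 * sqrt r) * mehler r (partial_deriv i g) x
       - 1 / 2 * mehler r (partial_deriv i (partial_deriv i g)) x)"
      using r by (intro sum.cong refl) (simp add: ibp)
    finally show ?thesis .
  qed
  ultimately show ?thesis by (simp add: mehler_def)
qed

section \<open>The energy identity\<close>

text \<open>This is the h of the overview. The semigroup multiplies degree k by r^(k/2), so after
  squaring only integer powers of r remain.\<close>

definition energy :: "('a::euclidean_space \<Rightarrow> real) \<Rightarrow> real \<Rightarrow> real" where
  "energy g r = (\<integral>x. (mehler r g x)\<^sup>2 \<partial>mu0)"

lemma energy_nonneg: "energy g r \<ge> 0"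
  by (simp add: energy_def)

lemma energy_0: "energy g 0 = (\<integral>x. g x \<partial>mu0)\<^sup>2"
  by (simp add: energy_def mehler_def)

lemma energy_1: "energy g 1 = (\<integral>x. (g x)\<^sup>2 \<partial>mu0)"
  by (simp add: energy_def mehler_def)

text \<open>Dominated convergence is used twice, for the Gaussian average inside
  \<open>mehler\<close> and for the outer integral. The closed interval matters because the
  derivative formula covers only 0 < r < 1.\<close>

lemma energy_continuous:
  assumes g: "g \<in> Cc_inf"
  shows "continuous_on {0..1} (energy g)"
proof -
  note [measurable] = Cc_inf_measurable[OF g]
  obtain B where B: "\<And>x. \<bar>g x\<bar> \<le> B" "B \<ge> 0" using Cc_inf_bounded[OF g] by metis
  have "continuous_on {0..1} (\<lambda>r. mehler r g x)" for x
    unfolding mehler_def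
  proof (rule continuous_on_parameter_integral)
    show "continuous_on {0..1} (\<lambda>t. g (sqrt t *\<^sub>R x + sqrt (1 - t) *\<^sub>R z))" for z
      by (rule continuous_on_compose2[OF Cc_inf_continuous[OF g, of UNIV]]) (auto intro!: continuous_intros)
    show "integrable mu0 (\<lambda>z::'a. B)" by simp
  qed (use B in auto)
  then show ?thesis
    unfolding energy_def[abs_def]
  proof (intro continuous_on_parameter_integral)
    show "\<bar>(mehler t g x)\<^sup>2\<bar> \<le> B\<^sup>2" for t x
      using mehler_bound[OF g B(1), of t x] B(2) power_mono[of "\<bar>mehler t g x\<bar>" B 2] by simp
    show "integrable mu0 (\<lambda>z::'a. B\<^sup>2)" by simp
    show "(\<lambda>x. (mehler t g x)\<^sup>2) \<in> borel_measurable mu0" for t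
      using mehler_measurable[OF g, of t] by simp
  qed (auto intro!: continuous_intros)
qed

text \<open>Two Gaussian integrations by parts, one inside the semigroup and one outside; the second
  derivatives cancel.\<close>

lemma energy_has_derivative:
  assumes g: "g \<in> Cc_inf" and r: "0 < r" "r < 1"
  shows "(energy g has_real_derivative (\<Sum>i\<in>Basis. energy (partial_deriv i g) r)) (at r)"
proof -
  note di = Cc_inf_partial_deriv[OF g]
  have dii: "partial_deriv i (partial_deriv i g) \<in> Cc_inf" if "i \<in> Basis" for i
    using Cc_inf_partial_deriv[OF di] that by blast
  obtain B0 where B0: "\<And>x. \<bar>g x\<bar> \<le> B0" "B0 \<ge> 0" using Cc_inf_bounded[OF g] by metis
  have "\<forall>i\<in>Basis. \<exists>B. \<forall>x. \<bar>partial_deriv i g x\<bar> \<le> B \<and> B \<ge> 0"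
    using Cc_inf_bounded[OF di] by metis
  then obtain B where B: "\<And>i x. i \<in> Basis \<Longrightarrow> \<bar>partial_deriv i g x\<bar> \<le> B i"
      "\<And>i. i \<in> Basis \<Longrightarrow> B i \<ge> 0"
    by metis
  have "\<forall>i\<in>Basis. \<exists>B. \<forall>x. \<bar>partial_deriv i (partial_deriv i g) x\<bar> \<le> B \<and> B \<ge> 0"
    using Cc_inf_bounded[OF dii] by metis
  then obtain C where C: "\<And>i x. i \<in> Basis \<Longrightarrow> \<bar>partial_deriv i (partial_deriv i g) x\<bar> \<le> C i"
      "\<And>i. i \<in> Basis \<Longrightarrow> C i \<ge> 0"
    by metis
  let ?P = "\<lambda>t x. mehler t g x"
  let ?Pi = "\<lambda>i t x. mehler t (partial_deriv i g) x"
  let ?Pii = "\<lambda>i t x. mehler t (partial_deriv i (partial_deriv i g)) x"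
  let ?D = "\<lambda>t x. \<Sum>i\<in>Basis. (x \<bullet> i) / (2 * sqrt t) * ?Pi i t x - 1 / 2 * ?Pii i t x"
  \<comment> \<open>Only the end 0 has to be avoided by a margin: after the inner integration by
    parts, 1 / sqrt t is the only singular coefficient left.\<close>
  let ?S = "{r / 2<..<1}"
  let ?w = "\<lambda>x::'a. 2 * (B0 * (\<Sum>i\<in>Basis. norm x / (2 * sqrt (r / 2)) * B i + 1 / 2 * C i))"
  have "((\<lambda>t. \<integral>x. (?P t x)\<^sup>2 \<partial>mu0) has_real_derivative (\<integral>x. 2 * (?P r x * ?D r x) \<partial>mu0)) (at r)"
  proof (rule has_real_derivative_parameter_integral(2)[of ?S])
    show "((\<lambda>t. (?P t x)\<^sup>2) has_real_derivative 2 * (?P t x * ?D t x)) (at t)" if "t \<in> ?S" for t x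
      using that r by (intro DERIV_cong[OF DERIV_power[OF mehler_time_derivative[OF g, of t x], of 2]]) auto
    show "integrable mu0 (\<lambda>x. (?P t x)\<^sup>2)" for t
      using g by (intro integrable_exp_bounded exp_bounded_power mehler_exp_bounded) auto
    show "\<bar>2 * (?P t x * ?D t x)\<bar> \<le> ?w x" if t: "t \<in> ?S" for t x
    proof -
      have "\<bar>?D t x\<bar> \<le> (\<Sum>i\<in>Basis. norm x / (2 * sqrt (r / 2)) * B i + 1 / 2 * C i)"
      proof (rule order_trans[OF sum_abs], rule sum_mono)
        fix i :: 'a assume i: "i \<in> Basis"
        have "\<bar>(x \<bullet> i) / (2 * sqrt t) * ?Pi i t x\<bar> \<le> norm x / (2 * sqrt (r / 2)) * B i"
          unfolding abs_mult abs_divide using t r B(2)[OF i] Basis_le_norm[OF i, of x]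
            mehler_bound[OF di[OF i] B(1)[OF i]]
          by (intro mult_mono frac_le) auto
        moreover have "\<bar>1 / 2 * ?Pii i t x\<bar> \<le> 1 / 2 * C i"
          unfolding abs_mult using mehler_bound[OF dii[OF i] C(1)[OF i]]
          by (intro mult_mono) auto
        ultimately show "\<bar>(x \<bullet> i) / (2 * sqrt t) * ?Pi i t x - 1 / 2 * ?Pii i t x\<bar>
            \<le> norm x / (2 * sqrt (r / 2)) * B i + 1 / 2 * C i"
          by linarith
      qed
      then have "\<bar>?P t x\<bar> * \<bar>?D t x\<bar> \<le> B0 * (\<Sum>i\<in>Basis. norm x / (2 * sqrt (r / 2)) * B i + 1 / 2 * C i)"
        using B0 mehler_bound[OF g B0(1)] by (intro mult_mono) auto
      then show ?thesis by (simp add: abs_mult)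
    qed
    show "integrable mu0 ?w"
      unfolding divide_inverse
      by (intro integrable_mult_right Bochner_Integration.integrable_sum integrable_exp_bounded
          exp_bounded_mult exp_bounded_add) auto
  qed (use r in auto)
  moreover have "(\<integral>x. 2 * (?P r x * ?D r x) \<partial>mu0) = (\<Sum>i\<in>Basis. energy (partial_deriv i g) r)"
  proof -
    have i1: "integrable mu0 (\<lambda>x. (x \<bullet> i) * (?P r x * ?Pi i r x))"
      and i2: "integrable mu0 (\<lambda>x. ?P r x * ?Pii i r x)"
      and i3: "integrable mu0 (\<lambda>x. (?Pi i r x)\<^sup>2)" if i: "i \<in> Basis" for i
    proof -
      note [measurable] = mehler_measurable[OF g, of r] mehler_measurable[OF di[OF i], of r]
        mehler_measurable[OF dii[OF i], of r]
      note b = mehler_exp_bounded[OF g, of r] mehler_exp_bounded[OF di[OF i], of r]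
        mehler_exp_bounded[OF dii[OF i], of r]
      show "integrable mu0 (\<lambda>x. (x \<bullet> i) * (?P r x * ?Pi i r x))"
        by (intro integrable_exp_bounded exp_bounded_mult exp_bounded_inner b) measurable
      show "integrable mu0 (\<lambda>x. ?P r x * ?Pii i r x)"
        by (intro integrable_exp_bounded exp_bounded_mult b) measurable
      show "integrable mu0 (\<lambda>x. (?Pi i r x)\<^sup>2)"
        by (intro integrable_exp_bounded exp_bounded_power b) measurable
    qed
    \<comment> \<open>The product rule and the commutation relation produce the common factor
      \<open>sqrt r\<close>, which cancels the 1 / sqrt r of the time derivative.\<close>
    have ibp: "(\<integral>x. (x \<bullet> i) * (?P r x * ?Pi i r x) \<partial>mu0)
      = sqrt r * (energy (partial_deriv i g) r + (\<integral>x. ?P r x * ?Pii i r x \<partial>mu0))" if i: "i \<in> Basis" for i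
    proof -
      have "(\<integral>x. (x \<bullet> i) * (?P r x * ?Pi i r x) \<partial>mu0)
        = (\<integral>x. sqrt r * ((?Pi i r x)\<^sup>2 + ?P r x * ?Pii i r x) \<partial>mu0)"
      proof (rule gaussian_integration_by_parts)
        show "((\<lambda>t. ?P r (x + t *\<^sub>R i) * ?Pi i r (x + t *\<^sub>R i)) has_real_derivative
            sqrt r * ((?Pi i r x)\<^sup>2 + ?P r x * ?Pii i r x)) (at 0)" for x
          using DERIV_mult[OF mehler_directional_derivative[OF g i, of r x]
              mehler_directional_derivative[OF di[OF i] i, of r x]] r
          by (simp add: power2_eq_square algebra_simps)
        show "exp_bounded (\<lambda>x. ?P r x * ?Pi i r x)"
          using g di[OF i] by (intro exp_bounded_mult mehler_exp_bounded)
        show "exp_bounded (\<lambda>x. sqrt r * ((?Pi i r x)\<^sup>2 + ?P r x * ?Pii i r x))"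
          using g di[OF i] dii[OF i]
          by (intro exp_bounded_mult exp_bounded_add exp_bounded_power mehler_exp_bounded exp_bounded_const)
      qed (use g di[OF i] i in auto)
      then show ?thesis using i2[OF i] i3[OF i] by (simp add: energy_def)
    qed
    have "(\<integral>x. 2 * (?P r x * ?D r x) \<partial>mu0) = (\<integral>x. (\<Sum>i\<in>Basis. 1 / sqrt r * ((x \<bullet> i) * (?P r x * ?Pi i r x))
        - ?P r x * ?Pii i r x) \<partial>mu0)"
      unfolding sum_distrib_left
      by (intro Bochner_Integration.integral_cong sum.cong refl) (simp add: right_diff_distrib)
    also have "\<dots> = (\<Sum>i\<in>Basis. 1 / sqrt r * (\<integral>x. (x \<bullet> i) * (?P r x * ?Pi i r x) \<partial>mu0)
        - (\<integral>x. ?P r x * ?Pii i r x \<partial>mu0))"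
      using i1 i2 by (subst Bochner_Integration.integral_sum) (auto intro!: sum.cong)
    also have "\<dots> = (\<Sum>i\<in>Basis. energy (partial_deriv i g) r)"
      using r by (intro sum.cong refl) (simp add: ibp)
    finally show ?thesis .
  qed
  ultimately show ?thesis by (simp add: energy_def[abs_def])
qed

section \<open>The trapezoidal rule and the inequality for test functions\<close>

text \<open>\<open>\<Phi> t\<close> is the error of the rule on [0,t]. Its derivative is (k t - k 0
  - t * l t) / 2, and this is not positive: by the mean value theorem k t - k 0 = t * l s for some s
  < t, and \<open>l\<close> is nondecreasing. Derivatives are assumed in the open interval only, as
  \<open>energy\<close> requires.\<close>

lemma trapezoidal_rule_le:
  fixes h k l :: "real \<Rightarrow> real"
  assumes h: "continuous_on {0..1} h" and k: "continuous_on {0..1} k"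
    and dh: "\<And>t. 0 < t \<Longrightarrow> t < 1 \<Longrightarrow> (h has_real_derivative k t) (at t)"
    and dk: "\<And>t. 0 < t \<Longrightarrow> t < 1 \<Longrightarrow> (k has_real_derivative l t) (at t)"
    and l: "\<And>s t. 0 < s \<Longrightarrow> s \<le> t \<Longrightarrow> t < 1 \<Longrightarrow> l s \<le> l t"
  shows "h 1 - h 0 \<le> (k 0 + k 1) / 2"
proof -
  define \<Phi> where "\<Phi> t = h t - h 0 - t * (k 0 + k t) / 2" for t
  have "\<Phi> 1 \<le> \<Phi> 0"
  proof (rule DERIV_nonpos_imp_decreasing_open[of 0 1 \<Phi>])
    show "continuous_on {0..1} \<Phi>"
      unfolding \<Phi>_def[abs_def] divide_inverse by (intro continuous_intros h k)
    fix t :: real assume t: "0 < t" "t < 1"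
    have d: "(\<Phi> has_real_derivative (k t - (k 0 + k t + t * l t) / 2)) (at t)"
      unfolding \<Phi>_def[abs_def]
      by (rule DERIV_cong[OF DERIV_diff[OF DERIV_diff[OF dh[OF t] DERIV_const]
            DERIV_cdivide[OF DERIV_mult[OF DERIV_ident DERIV_add[OF DERIV_const dk[OF t]]]]]])
        (simp add: field_simps)
    have "k t - k 0 \<le> t * l t"
    proof -
      have "continuous_on {0..t} k"
        using k t by (auto intro: continuous_on_subset)
      then obtain y s where s: "0 < s" "s < t" "(k has_real_derivative y) (at s)" "k t - k 0 = (t - 0) * y"
        using MVT[OF t(1), of k] dk t(2) by (meson less_trans real_differentiable_def)
      then have "y = l s" using DERIV_unique[OF s(3) dk[OF s(1)]] t(2) by linarith
      moreover have "l s \<le> l t" using l[OF s(1)] s(2) t(2) by simp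
      ultimately show ?thesis using s(4) t(1) by (simp add: mult_left_mono)
    qed
    then have "k t - (k 0 + k t + t * l t) / 2 \<le> 0" by (simp add: field_simps)
    with d show "\<exists>y. (\<Phi> has_real_derivative y) (at t) \<and> y \<le> 0" by blast
  qed simp
  then show ?thesis by (simp add: \<Phi>_def field_simps)
qed

lemma gaussian_poincare_second_order:
  assumes g: "g \<in> Cc_inf"
  shows "(\<integral>x. (g x)\<^sup>2 \<partial>mu0) - (\<integral>x. g x \<partial>mu0)\<^sup>2
    \<le> ((\<Sum>i\<in>Basis. (\<integral>x. partial_deriv i g x \<partial>mu0)\<^sup>2) +
        (\<Sum>i\<in>Basis. \<integral>x. (partial_deriv i g x)\<^sup>2 \<partial>mu0)) / 2"
proof -
  let ?d = partial_deriv
  note d1 = Cc_inf_partial_deriv[OF g]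
  have d2: "?d j (?d i g) \<in> Cc_inf" if "i \<in> Basis" "j \<in> Basis" for i j
    using that d1 Cc_inf_partial_deriv by blast
  have "energy g 1 - energy g 0 \<le> ((\<Sum>i\<in>Basis. energy (?d i g) 0) + (\<Sum>i\<in>Basis. energy (?d i g) 1)) / 2"
  proof (rule trapezoidal_rule_le[where l = "\<lambda>t. \<Sum>i\<in>Basis. \<Sum>j\<in>Basis. energy (?d j (?d i g)) t"])
    show "(\<Sum>i\<in>Basis. \<Sum>j\<in>Basis. energy (?d j (?d i g)) s) \<le> (\<Sum>i\<in>Basis. \<Sum>j\<in>Basis. energy (?d j (?d i g)) t)"
      if "0 < s" "s \<le> t" "t < 1" for s t
    proof (intro sum_mono)
      fix i j :: 'a assume "i \<in> Basis" "j \<in> Basis"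
      note e = energy_has_derivative[OF d2[OF this]]
      \<comment> \<open>The derivative is a sum of energies of third derivatives of
        \<open>g\<close>, hence not negative.\<close>
      show "energy (?d j (?d i g)) s \<le> energy (?d j (?d i g)) t"
      proof (rule DERIV_nonneg_imp_nondecreasing[OF that(2)])
        fix x assume "s \<le> x" "x \<le> t"
        then show "\<exists>y. (energy (?d j (?d i g)) has_real_derivative y) (at x) \<and> 0 \<le> y"
          using e[of x] that by (auto intro!: exI sum_nonneg energy_nonneg)
      qed
    qed
  qed (auto intro!: energy_continuous continuous_on_sum DERIV_sum energy_has_derivative g d1)
  then show ?thesis by (simp add: energy_0 energy_1)
qed

subsection \<open>Square-integrable functions\<close>

text \<open>Vector-valued L^2, so that a function and its gradient are covered by the same
  lemmas.\<close>

definition sq_integrable :: "('a::euclidean_space \<Rightarrow> 'b::euclidean_space) \<Rightarrow> bool" where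
  "sq_integrable f \<longleftrightarrow> f \<in> borel_measurable borel \<and> integrable mu0 (\<lambda>x. (norm (f x))\<^sup>2)"

lemma sq_integrable_measurable: "sq_integrable f \<Longrightarrow> f \<in> borel_measurable borel"
  by (simp add: sq_integrable_def)

lemma sq_integrable_bound:
  assumes "sq_integrable f" "sq_integrable g" "h \<in> borel_measurable borel"
    "\<And>x. (norm (h x))\<^sup>2 \<le> C * ((norm (f x))\<^sup>2 + (norm (g x))\<^sup>2)"
  shows "sq_integrable h"
proof -
  have "integrable mu0 (\<lambda>x. (norm (h x))\<^sup>2)"
  proof (rule Bochner_Integration.integrable_bound)
    show "integrable mu0 (\<lambda>x. C * ((norm (f x))\<^sup>2 + (norm (g x))\<^sup>2))"
      using assms(1,2) by (simp add: sq_integrable_def)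
    show "AE x in mu0. norm ((norm (h x))\<^sup>2) \<le> norm (C * ((norm (f x))\<^sup>2 + (norm (g x))\<^sup>2))"
    proof (rule AE_I2)
      fix x show "norm ((norm (h x))\<^sup>2) \<le> norm (C * ((norm (f x))\<^sup>2 + (norm (g x))\<^sup>2))"
        using assms(4)[of x] by (simp add: abs_le_iff)
    qed
  qed (use assms(3) in measurable)
  with assms(3) show ?thesis by (simp add: sq_integrable_def)
qed

lemma norm_add_sq_le:
  fixes a b :: "'b::real_normed_vector"
  shows "(norm (a + b))\<^sup>2 \<le> 2 * ((norm a)\<^sup>2 + (norm b)\<^sup>2)"
proof -
  have "(norm (a + b))\<^sup>2 \<le> (norm a + norm b)\<^sup>2"
    by (rule power_mono[OF norm_triangle_ineq]) simp
  also have "\<dots> \<le> 2 * ((norm a)\<^sup>2 + (norm b)\<^sup>2)"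
    using sum_squares_bound[of "norm a" "norm b"] by (simp add: power2_sum)
  finally show ?thesis .
qed

lemma sq_integrable_add:
  assumes "sq_integrable f" "sq_integrable g"
  shows "sq_integrable (\<lambda>x. f x + g x)"
  by (rule sq_integrable_bound[OF assms])
    (use assms[THEN sq_integrable_measurable] in \<open>auto intro: norm_add_sq_le\<close>)

lemma sq_integrable_scaleR:
  assumes "sq_integrable f"
  shows "sq_integrable (\<lambda>x. t *\<^sub>R f x)"
  using assms borel_measurable_scaleR[of "\<lambda>x. t" borel f]
  by (simp add: sq_integrable_def power_mult_distrib)

lemma sq_integrable_diff:
  assumes "sq_integrable f" "sq_integrable g"
  shows "sq_integrable (\<lambda>x. f x - g x)"
  using sq_integrable_add[OF assms(1) sq_integrable_scaleR[OF assms(2), of "-1"]] by simp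

lemma sq_integrable_exp_bounded:
  assumes "exp_bounded (\<lambda>x. norm (f x))" "f \<in> borel_measurable borel"
  shows "sq_integrable f"
  using assms unfolding sq_integrable_def
  by (auto intro!: integrable_exp_bounded exp_bounded_power)

lemma sq_integrable_const[simp]: "sq_integrable (\<lambda>x. c)"
  by (rule sq_integrable_exp_bounded) auto

lemma exp_bounded_abs: "exp_bounded f \<Longrightarrow> exp_bounded (\<lambda>x. \<bar>f x\<bar>)"
  by (simp add: exp_bounded_def)

lemma sq_integrable_inner_const[simp]: "sq_integrable (\<lambda>x. x \<bullet> b)"
  by (rule sq_integrable_exp_bounded) (auto intro: exp_bounded_abs)

lemma sq_integrable_ident[simp]: "sq_integrable (\<lambda>x::'a::euclidean_space. x)"
  by (rule sq_integrable_exp_bounded) auto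

lemma integrable_norm_mult:
  assumes "sq_integrable f" "sq_integrable g"
  shows "integrable mu0 (\<lambda>x. norm (f x) * norm (g x))"
proof (rule Bochner_Integration.integrable_bound)
  show "integrable mu0 (\<lambda>x. (norm (f x))\<^sup>2 + (norm (g x))\<^sup>2)"
    using assms by (simp add: sq_integrable_def)
  show "AE x in mu0. norm (norm (f x) * norm (g x)) \<le> norm ((norm (f x))\<^sup>2 + (norm (g x))\<^sup>2)"
  proof (rule AE_I2)
    fix x
    have "0 \<le> norm (f x) * norm (g x)" by simp
    moreover have "2 * (norm (f x) * norm (g x)) \<le> (norm (f x))\<^sup>2 + (norm (g x))\<^sup>2"
      using sum_squares_bound[of "norm (f x)" "norm (g x)"] by simp
    ultimately show "norm (norm (f x) * norm (g x)) \<le> norm ((norm (f x))\<^sup>2 + (norm (g x))\<^sup>2)"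
      unfolding real_norm_def by linarith
  qed
qed (use assms[THEN sq_integrable_measurable] in measurable)

lemma integrable_inner:
  assumes "sq_integrable f" "sq_integrable g"
  shows "integrable mu0 (\<lambda>x. f x \<bullet> g x)"
  by (rule Bochner_Integration.integrable_bound[OF integrable_norm_mult[OF assms]])
    (use assms[THEN sq_integrable_measurable] in \<open>auto simp: Cauchy_Schwarz_ineq2\<close>)

lemma integrable_sq_integrable:
  assumes "sq_integrable f"
  shows "integrable mu0 f"
proof (rule integrable_norm_cancel)
  show "integrable mu0 (\<lambda>x. norm (f x))"
    using integrable_norm_mult[OF assms sq_integrable_const[of "1::real"]] by simp
qed (use sq_integrable_measurable[OF assms] in simp)

lemma nonneg_quadratic_discriminant:
  fixes A B C :: real
  assumes q: "\<And>t. 0 \<le> A + 2 * t * B + t\<^sup>2 * C" and "C \<ge> 0"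
  shows "B\<^sup>2 \<le> A * C"
proof (cases "C = 0")
  case True
  have "B = 0"
  proof (rule ccontr)
    assume "B \<noteq> 0"
    \<comment> \<open>With C = 0 the quadratic is affine in t, and this t makes its value
      -1.\<close>
    then have "2 * (- (A + 1) / (2 * B)) * B = - (A + 1)" by simp
    with q[of "- (A + 1) / (2 * B)"] True show False by simp
  qed
  then show ?thesis by (simp add: True)
next
  case False
  with assms(2) have C: "C > 0" by simp
  \<comment> \<open>-B/C is the minimiser of the quadratic; multiplying by C clears the
    denominator.\<close>
  have "0 \<le> (A + 2 * (- B / C) * B + (- B / C)\<^sup>2 * C) * C"
    using q[of "- B / C"] C by simp
  also have "\<dots> = A * C - B\<^sup>2"
    using C by (simp add: field_simps power2_eq_square)
  finally show ?thesis by simp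
qed

lemma integral_Cauchy_Schwarz:
  assumes f: "sq_integrable f" and g: "sq_integrable g"
  shows "\<bar>\<integral>x. f x \<bullet> g x \<partial>mu0\<bar> \<le> sqrt (\<integral>x. (norm (f x))\<^sup>2 \<partial>mu0) * sqrt (\<integral>x. (norm (g x))\<^sup>2 \<partial>mu0)"
proof -
  let ?A = "\<integral>x. (norm (f x))\<^sup>2 \<partial>mu0" and ?B = "\<integral>x. f x \<bullet> g x \<partial>mu0" and ?C = "\<integral>x. (norm (g x))\<^sup>2 \<partial>mu0"
  have int: "integrable mu0 (\<lambda>x. (norm (f x))\<^sup>2)" "integrable mu0 (\<lambda>x. f x \<bullet> g x)" "integrable mu0 (\<lambda>x. (norm (g x))\<^sup>2)"
    using f g integrable_inner[OF f g] by (auto simp: sq_integrable_def)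
  have q: "0 \<le> ?A + 2 * t * ?B + t\<^sup>2 * ?C" for t
  proof -
    have "0 \<le> (\<integral>x. (norm (f x + t *\<^sub>R g x))\<^sup>2 \<partial>mu0)" by simp
    also have "\<dots> = (\<integral>x. (norm (f x))\<^sup>2 + (2 * t) * (f x \<bullet> g x) + t\<^sup>2 * (norm (g x))\<^sup>2 \<partial>mu0)"
      by (intro Bochner_Integration.integral_cong refl)
        (simp add: power2_norm_eq_inner inner_add_left inner_add_right inner_commute power2_eq_square[of t])
    also have "\<dots> = ?A + 2 * t * ?B + t\<^sup>2 * ?C" using int by simp
    finally show ?thesis .
  qed
  have "?B\<^sup>2 \<le> ?A * ?C"
    by (rule nonneg_quadratic_discriminant[OF q]) simp
  then show ?thesis
    by (simp add: real_sqrt_mult[symmetric] real_le_rsqrt)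
qed

text \<open>Some \<open>f n\<close> has finite distance to \<open>g\<close>, so \<open>g\<close> is
  a difference of two square-integrable functions. Once that is known, the extended integrals in
  \<open>X0\<close> may be replaced by Bochner integrals.\<close>

lemma sq_integrable_limit:
  assumes f: "\<And>n. sq_integrable (f n)" and m: "g \<in> borel_measurable borel"
    and lim: "(\<lambda>n. \<integral>\<^sup>+ x. ennreal ((norm (f n x - g x))\<^sup>2) \<partial>mu0) \<longlonglongrightarrow> 0"
  shows "sq_integrable g"
    and "(\<lambda>n. \<integral>x. (norm (f n x - g x))\<^sup>2 \<partial>mu0) \<longlonglongrightarrow> 0"
proof -
  note [measurable] = m sq_integrable_measurable[OF f]
  have "eventually (\<lambda>n. (\<integral>\<^sup>+ x. ennreal ((norm (f n x - g x))\<^sup>2) \<partial>mu0) < 1) sequentially"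
    using lim by (rule order_tendstoD) simp
  then obtain n where n: "(\<integral>\<^sup>+ x. ennreal ((norm (f n x - g x))\<^sup>2) \<partial>mu0) < 1"
    using eventually_happens by fastforce
  have "integrable mu0 (\<lambda>x. (norm (f n x - g x))\<^sup>2)"
    by (rule integrableI_bounded) (use n in \<open>auto intro: less_trans simp: less_top[symmetric]\<close>)
  then have d: "sq_integrable (\<lambda>x. f n x - g x)"
    by (simp add: sq_integrable_def)
  show g: "sq_integrable g"
    using sq_integrable_diff[OF f[of n] d] by simp
  have "(\<integral>\<^sup>+ x. ennreal ((norm (f n x - g x))\<^sup>2) \<partial>mu0) = ennreal (\<integral>x. (norm (f n x - g x))\<^sup>2 \<partial>mu0)" for n
    using sq_integrable_diff[OF f[of n] g] by (intro nn_integral_eq_integral) (auto simp: sq_integrable_def)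
  with lim have "(\<lambda>n. ennreal (\<integral>x. (norm (f n x - g x))\<^sup>2 \<partial>mu0)) \<longlonglongrightarrow> ennreal 0"
    by simp
  then show "(\<lambda>n. \<integral>x. (norm (f n x - g x))\<^sup>2 \<partial>mu0) \<longlonglongrightarrow> 0"
    by (subst (asm) tendsto_ennreal_iff) auto
qed

text \<open>Continuity of the L^2 inner product. Every limit needed for \<open>X0\<close> is an
  instance: squared norms when both sequences agree, means and first moments when the second
  sequence is constant.\<close>

lemma integral_inner_tendsto:
  assumes f: "\<And>n. sq_integrable (f n)" "sq_integrable f0"
    and g: "\<And>n. sq_integrable (g n)" "sq_integrable g0"
    and limf: "(\<lambda>n. \<integral>x. (norm (f n x - f0 x))\<^sup>2 \<partial>mu0) \<longlonglongrightarrow> 0"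
    and limg: "(\<lambda>n. \<integral>x. (norm (g n x - g0 x))\<^sup>2 \<partial>mu0) \<longlonglongrightarrow> 0"
  shows "(\<lambda>n. \<integral>x. f n x \<bullet> g n x \<partial>mu0) \<longlonglongrightarrow> (\<integral>x. f0 x \<bullet> g0 x \<partial>mu0)"
proof -
  let ?a = "\<lambda>n. \<integral>x. (norm (f n x - f0 x))\<^sup>2 \<partial>mu0" and ?b = "\<lambda>n. \<integral>x. (norm (g n x - g0 x))\<^sup>2 \<partial>mu0"
  let ?F = "\<integral>x. (norm (f0 x))\<^sup>2 \<partial>mu0" and ?G = "\<integral>x. (norm (g0 x))\<^sup>2 \<partial>mu0"
  let ?r = "\<lambda>n. sqrt (?a n) * sqrt (?b n) + sqrt (?a n) * sqrt ?G + sqrt ?F * sqrt (?b n)"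
  have "?r \<longlonglongrightarrow> sqrt 0 * sqrt 0 + sqrt 0 * sqrt ?G + sqrt ?F * sqrt 0"
    by (intro tendsto_intros limf limg)
  then have r: "?r \<longlonglongrightarrow> 0" by simp
  have "\<bar>(\<integral>x. f n x \<bullet> g n x \<partial>mu0) - (\<integral>x. f0 x \<bullet> g0 x \<partial>mu0)\<bar> \<le> ?r n" for n
  proof -
    note df = sq_integrable_diff[OF f(1)[of n] f(2)] and dg = sq_integrable_diff[OF g(1)[of n] g(2)]
    have "(\<integral>x. f n x \<bullet> g n x \<partial>mu0)
      = (\<integral>x. (f n x - f0 x) \<bullet> (g n x - g0 x) + (f n x - f0 x) \<bullet> g0 x + f0 x \<bullet> (g n x - g0 x) + f0 x \<bullet> g0 x \<partial>mu0)"
      by (intro Bochner_Integration.integral_cong refl) (simp add: inner_diff_left inner_diff_right)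
    also have "\<dots> = (\<integral>x. (f n x - f0 x) \<bullet> (g n x - g0 x) \<partial>mu0) + (\<integral>x. (f n x - f0 x) \<bullet> g0 x \<partial>mu0)
        + (\<integral>x. f0 x \<bullet> (g n x - g0 x) \<partial>mu0) + (\<integral>x. f0 x \<bullet> g0 x \<partial>mu0)"
      using integrable_inner[OF df dg] integrable_inner[OF df g(2)] integrable_inner[OF f(2) dg]
        integrable_inner[OF f(2) g(2)] by simp
    finally show ?thesis
      using integral_Cauchy_Schwarz[OF df dg] integral_Cauchy_Schwarz[OF df g(2)] integral_Cauchy_Schwarz[OF f(2) dg]
      by linarith
  qed
  then have "(\<lambda>n. (\<integral>x. f n x \<bullet> g n x \<partial>mu0) - (\<integral>x. f0 x \<bullet> g0 x \<partial>mu0)) \<longlonglongrightarrow> 0"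
    by (intro Lim_null_comparison[OF always_eventually r] allI) (simp only: real_norm_def)
  then show ?thesis by (rule LIM_zero_cancel)
qed

section \<open>Low Gaussian moments and expansion of the squares\<close>

text \<open>Integration by parts with F = 1. It requires a unit direction, hence
  \<open>sgn c\<close> and the separate case c = 0; the second moment below takes F linear.\<close>

lemma integral_mu0_inner: "(\<integral>x. x \<bullet> c \<partial>mu0) = 0"
proof (cases "c = 0")
  case False
  have "(\<integral>x. (x \<bullet> sgn c) * 1 \<partial>mu0) = (\<integral>x. 0 \<partial>(mu0 :: 'a measure))"
    by (rule gaussian_integration_by_parts) (use False in \<open>auto simp: norm_sgn\<close>)
  then show ?thesis using False by (simp add: sgn_div_norm)
qed simp

lemma integral_mu0_inner_sq: "(\<integral>x. (x \<bullet> c)\<^sup>2 \<partial>mu0) = (norm c)\<^sup>2"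
proof (cases "c = 0")
  case False
  then have s: "sgn c \<bullet> sgn c = 1" by (simp add: norm_sgn flip: power2_norm_eq_inner)
  have "(\<integral>x. (x \<bullet> sgn c) * (x \<bullet> sgn c) \<partial>mu0) = (\<integral>x. 1 \<partial>(mu0 :: 'a measure))"
    by (rule gaussian_integration_by_parts)
      (use False s in \<open>auto intro!: derivative_eq_intros simp: norm_sgn inner_add_left\<close>)
  then have 1: "(\<integral>x. (x \<bullet> sgn c)\<^sup>2 \<partial>mu0) = 1" by (simp add: power2_eq_square)
  have "x \<bullet> c = norm c * (x \<bullet> sgn c)" for x
    using False by (simp add: sgn_div_norm flip: mult.assoc)
  then have "(x \<bullet> c)\<^sup>2 = (norm c)\<^sup>2 * (x \<bullet> sgn c)\<^sup>2" for x
    by (simp only: power_mult_distrib)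
  then show ?thesis using 1 by simp
qed simp

text \<open>m is the mean of \<open>u\<close> and, by \<open>mean\<close>, c is the mean of
  \<open>G\<close>. Moreover m + c \<bullet> x is the L^2 projection of \<open>u\<close> onto affine
  functions, with squared norm m^2 + |c|^2, so all three identities are instances of
  Pythagoras.\<close>

lemma gaussian_identities:
  fixes u :: "'a::euclidean_space \<Rightarrow> real" and G :: "'a \<Rightarrow> 'a"
  assumes u: "sq_integrable u" and G: "sq_integrable G"
  defines "m \<equiv> \<integral>x. u x \<partial>mu0" and "c \<equiv> \<integral>x. u x *\<^sub>R x \<partial>mu0"
  assumes mean: "(\<integral>x. G x \<partial>mu0) = c"
  shows "(\<integral>x. (u x - m)\<^sup>2 \<partial>mu0) = (\<integral>x. (u x)\<^sup>2 \<partial>mu0) - m\<^sup>2"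
    and "(\<integral>x. (norm (G x - c))\<^sup>2 \<partial>mu0) = (\<integral>x. (norm (G x))\<^sup>2 \<partial>mu0) - (norm c)\<^sup>2"
    and "(\<integral>x. (u x - m - c \<bullet> x)\<^sup>2 \<partial>mu0) = (\<integral>x. (u x)\<^sup>2 \<partial>mu0) - m\<^sup>2 - (norm c)\<^sup>2"
proof -
  have iu: "integrable mu0 u" and iu2: "integrable mu0 (\<lambda>x. (u x)\<^sup>2)" and iG: "integrable mu0 G"
    and iG2: "integrable mu0 (\<lambda>x. (norm (G x))\<^sup>2)"
    using u G integrable_sq_integrable[OF u] integrable_sq_integrable[OF G] by (auto simp: sq_integrable_def)
  have iux: "integrable mu0 (\<lambda>x. u x *\<^sub>R x)"
    by (rule Bochner_Integration.integrable_bound[OF integrable_norm_mult[OF u sq_integrable_ident]])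
      (use sq_integrable_measurable[OF u] in auto)
  have ix: "integrable mu0 (\<lambda>x. x \<bullet> c)" "integrable mu0 (\<lambda>x. (x \<bullet> c)\<^sup>2)"
    using sq_integrable_inner_const[of c] integrable_sq_integrable[OF sq_integrable_inner_const[of c]]
    by (simp_all add: sq_integrable_def del: sq_integrable_inner_const)
  have iuxc: "integrable mu0 (\<lambda>x. u x * (x \<bullet> c))"
    using integrable_inner_left[OF iux, of c] by simp
  have uxc: "(\<integral>x. u x * (x \<bullet> c) \<partial>mu0) = (norm c)\<^sup>2"
    using integral_inner_left[OF iux, of c] by (simp add: power2_norm_eq_inner flip: c_def)
  have "(\<integral>x. (u x - m)\<^sup>2 \<partial>mu0) = (\<integral>x. (u x)\<^sup>2 - (2 * m) * u x + m\<^sup>2 \<partial>mu0)"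
    by (intro Bochner_Integration.integral_cong refl) (simp add: power2_diff)
  also have "\<dots> = (\<integral>x. (u x)\<^sup>2 \<partial>mu0) - m\<^sup>2"
    using iu iu2 by (simp add: power2_eq_square flip: m_def)
  finally show "(\<integral>x. (u x - m)\<^sup>2 \<partial>mu0) = (\<integral>x. (u x)\<^sup>2 \<partial>mu0) - m\<^sup>2" .
  have "(\<integral>x. (norm (G x - c))\<^sup>2 \<partial>mu0) = (\<integral>x. (norm (G x))\<^sup>2 - 2 * (G x \<bullet> c) + (norm c)\<^sup>2 \<partial>mu0)"
    by (intro Bochner_Integration.integral_cong refl)
      (simp add: power2_norm_eq_inner inner_diff_left inner_diff_right inner_commute)
  also have "\<dots> = (\<integral>x. (norm (G x))\<^sup>2 \<partial>mu0) - (norm c)\<^sup>2"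
    using iG iG2 by (simp add: mean power2_norm_eq_inner)
  finally show "(\<integral>x. (norm (G x - c))\<^sup>2 \<partial>mu0) = (\<integral>x. (norm (G x))\<^sup>2 \<partial>mu0) - (norm c)\<^sup>2" .
  have "(\<integral>x. (u x - m - c \<bullet> x)\<^sup>2 \<partial>mu0) = (\<integral>x. (u x)\<^sup>2 - (2 * m) * u x + m\<^sup>2 - 2 * (u x * (x \<bullet> c))
      + (2 * m) * (x \<bullet> c) + (x \<bullet> c)\<^sup>2 \<partial>mu0)"
    by (intro Bochner_Integration.integral_cong refl)
      (simp add: power2_diff inner_commute right_diff_distrib left_diff_distrib)
  also have "\<dots> = (\<integral>x. (u x)\<^sup>2 \<partial>mu0) - m\<^sup>2 - (norm c)\<^sup>2"
    using iu iu2 iuxc ix by (simp add: integral_mu0_inner integral_mu0_inner_sq uxc flip: m_def) (simp add: power2_eq_square)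
  finally show "(\<integral>x. (u x - m - c \<bullet> x)\<^sup>2 \<partial>mu0) = (\<integral>x. (u x)\<^sup>2 \<partial>mu0) - m\<^sup>2 - (norm c)\<^sup>2" .
qed

section \<open>Passage from test functions to \<open>X0\<close>\<close>

lemma Cc_inf_sq_integrable:
  assumes "g \<in> Cc_inf"
  shows "sq_integrable g"
proof -
  obtain B where B: "\<And>x. \<bar>g x\<bar> \<le> B" using Cc_inf_bounded[OF assms(1)] by metis
  then show ?thesis
    using Cc_inf_measurable[OF assms]
    by (intro sq_integrable_exp_bounded exp_bounded_bound[of _ B]) auto
qed

text \<open>Each quantity is continuous under L^2 convergence of function and gradient, so the
  integration-by-parts identity and the inequality survive the limit. The identity makes the mean of
  \<open>G\<close> interchangeable with the first moment of \<open>u\<close>.\<close>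

lemma X0_inequality:
  fixes u :: "'a::euclidean_space \<Rightarrow> real" and G :: "'a \<Rightarrow> 'a"
  assumes "X0 u G"
  shows "sq_integrable u" "sq_integrable G"
    and "(\<integral>x. G x \<partial>mu0) = (\<integral>x. u x *\<^sub>R x \<partial>mu0)"
    and "(\<integral>x. (u x)\<^sup>2 \<partial>mu0) - (\<integral>x. u x \<partial>mu0)\<^sup>2
       \<le> ((norm (\<integral>x. G x \<partial>mu0))\<^sup>2 + (\<integral>x. (norm (G x))\<^sup>2 \<partial>mu0)) / 2"
proof -
  obtain \<phi> G\<phi> where \<phi>: "\<And>n. \<phi> n \<in> Cc_inf"
    and G\<phi>: "\<And>n x. (\<phi> n has_derivative (\<lambda>h. G\<phi> n x \<bullet> h)) (at x)"
    and lim: "(\<lambda>n. \<integral>\<^sup>+ x. ennreal ((\<phi> n x - u x)\<^sup>2) \<partial>mu0) \<longlonglongrightarrow> 0"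
      "(\<lambda>n. \<integral>\<^sup>+ x. ennreal ((norm (G\<phi> n x - G x))\<^sup>2) \<partial>mu0) \<longlonglongrightarrow> 0"
    and meas: "u \<in> borel_measurable borel" "G \<in> borel_measurable borel"
    using assms unfolding X0_def by blast
  have pd: "G\<phi> n x \<bullet> i = partial_deriv i (\<phi> n) x" for n x i
    using frechet_derivative_at[OF G\<phi>[of n x]] by (simp add: partial_deriv_def)
  have l\<phi>: "sq_integrable (\<phi> n)" for n
    by (rule Cc_inf_sq_integrable[OF \<phi>])
  have dl: "sq_integrable (partial_deriv i (\<phi> n))" if "i \<in> Basis" for i n
    by (rule Cc_inf_sq_integrable[OF Cc_inf_partial_deriv[OF \<phi> that]])
  have G2: "(norm (G\<phi> n x))\<^sup>2 = (\<Sum>i\<in>Basis. (partial_deriv i (\<phi> n) x)\<^sup>2)" for n x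
    by (subst norm_sq_eq_sum_Basis) (simp add: pd)
  \<comment> \<open>\<open>X0\<close> does not state measurability of the approximating gradients;
    it is read off their coordinates, which are test functions.\<close>
  have lG: "sq_integrable (G\<phi> n)" for n
  proof -
    have "G\<phi> n = (\<lambda>x. \<Sum>i\<in>Basis. partial_deriv i (\<phi> n) x *\<^sub>R i)"
      by (rule ext, subst euclidean_representation[symmetric]) (simp add: pd)
    moreover have "(\<lambda>x. \<Sum>i\<in>Basis. partial_deriv i (\<phi> n) x *\<^sub>R i) \<in> borel_measurable borel"
      using sq_integrable_measurable[OF dl] by (intro borel_measurable_sum borel_measurable_scaleR) auto
    moreover have "integrable mu0 (\<lambda>x. (norm (G\<phi> n x))\<^sup>2)"
      unfolding G2 using dl[of _ n] by (intro Bochner_Integration.integrable_sum) (auto simp: sq_integrable_def)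
    ultimately show ?thesis by (simp add: sq_integrable_def)
  qed
  have lim1: "(\<lambda>n. \<integral>\<^sup>+ x. ennreal ((norm (\<phi> n x - u x))\<^sup>2) \<partial>mu0) \<longlonglongrightarrow> 0"
    using lim(1) by simp
  note u = sq_integrable_limit[OF l\<phi> meas(1) lim1]
  note G = sq_integrable_limit[OF lG meas(2) lim(2)]
  show "sq_integrable u" "sq_integrable G" by (rule u(1), rule G(1))
  have const: "(\<lambda>n. \<integral>x. (norm (f x - f x))\<^sup>2 \<partial>mu0) \<longlonglongrightarrow> 0" for f :: "'a \<Rightarrow> 'b::real_normed_vector"
    by simp
  have A: "(\<lambda>n. \<integral>x. (\<phi> n x)\<^sup>2 \<partial>mu0) \<longlonglongrightarrow> (\<integral>x. (u x)\<^sup>2 \<partial>mu0)"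
    using integral_inner_tendsto[OF l\<phi> u(1) l\<phi> u(1) u(2) u(2)] by (simp add: power2_eq_square)
  have B: "(\<lambda>n. \<integral>x. (norm (G\<phi> n x))\<^sup>2 \<partial>mu0) \<longlonglongrightarrow> (\<integral>x. (norm (G x))\<^sup>2 \<partial>mu0)"
    using integral_inner_tendsto[OF lG G(1) lG G(1) G(2) G(2)] by (simp add: power2_norm_eq_inner)
  have M: "(\<lambda>n. \<integral>x. \<phi> n x \<partial>mu0) \<longlonglongrightarrow> (\<integral>x. u x \<partial>mu0)"
    using integral_inner_tendsto[OF l\<phi> u(1) sq_integrable_const sq_integrable_const u(2) const, of "1::real"] by simp
  have D: "(\<lambda>n. \<integral>x. G\<phi> n x \<bullet> i \<partial>mu0) \<longlonglongrightarrow> (\<integral>x. G x \<bullet> i \<partial>mu0)" for i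
    by (rule integral_inner_tendsto[OF lG G(1) sq_integrable_const sq_integrable_const G(2) const])
  have C: "(\<lambda>n. \<integral>x. \<phi> n x * (x \<bullet> i) \<partial>mu0) \<longlonglongrightarrow> (\<integral>x. u x * (x \<bullet> i) \<partial>mu0)" for i
    using integral_inner_tendsto[OF l\<phi> u(1) sq_integrable_inner_const sq_integrable_inner_const u(2) const, of i] by simp
  have CD: "(\<integral>x. \<phi> n x * (x \<bullet> i) \<partial>mu0) = (\<integral>x. G\<phi> n x \<bullet> i \<partial>mu0)" if i: "i \<in> Basis" for n i
  proof -
    obtain K where K: "\<And>x. \<bar>\<phi> n x\<bar> \<le> K" using Cc_inf_bounded[OF \<phi>] by metis
    obtain L where L: "\<And>x. \<bar>partial_deriv i (\<phi> n) x\<bar> \<le> L"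
      using Cc_inf_bounded[OF Cc_inf_partial_deriv[OF \<phi> i]] by metis
    have "(\<integral>x. (x \<bullet> i) * \<phi> n x \<partial>mu0) = (\<integral>x. partial_deriv i (\<phi> n) x \<partial>mu0)"
    proof (rule gaussian_integration_by_parts)
      show "((\<lambda>t. \<phi> n (x + t *\<^sub>R i)) has_real_derivative partial_deriv i (\<phi> n) x) (at 0)" for x
      proof -
        have "((\<lambda>t. x + t *\<^sub>R i) has_vector_derivative 1 *\<^sub>R i) (at 0)"
          unfolding has_vector_derivative_def by (auto intro!: derivative_eq_intros)
        from Cc_inf_chain[OF \<phi> this, unfolded scaleR_zero_left add_0_right] show ?thesis
          using i by (simp only: sum_scaled_Basis mult_1)
      qed
    qed (use i K L Cc_inf_measurable[OF \<phi>] in \<open>auto intro: exp_bounded_bound\<close>)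
    then show ?thesis by (simp add: pd mult.commute)
  qed
  have iux: "integrable mu0 (\<lambda>x. u x *\<^sub>R x)"
    by (rule Bochner_Integration.integrable_bound[OF integrable_norm_mult[OF u(1) sq_integrable_ident]])
      (use meas in auto)
  have iG: "integrable mu0 G" by (rule integrable_sq_integrable[OF G(1)])
  show "(\<integral>x. G x \<partial>mu0) = (\<integral>x. u x *\<^sub>R x \<partial>mu0)"
  proof (rule euclidean_eqI)
    fix i :: 'a assume i: "i \<in> Basis"
    have "(\<integral>x. G x \<bullet> i \<partial>mu0) = (\<integral>x. (u x *\<^sub>R x) \<bullet> i \<partial>mu0)"
      using LIMSEQ_unique[OF D[of i], of "\<integral>x. u x * (x \<bullet> i) \<partial>mu0"] C[of i] CD[OF i] by simp
    then show "(\<integral>x. G x \<partial>mu0) \<bullet> i = (\<integral>x. u x *\<^sub>R x \<partial>mu0) \<bullet> i"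
      using iux iG by (simp only: integral_inner_left)
  qed
  have ineq: "(\<integral>x. (\<phi> n x)\<^sup>2 \<partial>mu0) - (\<integral>x. \<phi> n x \<partial>mu0)\<^sup>2
      \<le> ((\<Sum>i\<in>Basis. (\<integral>x. G\<phi> n x \<bullet> i \<partial>mu0)\<^sup>2) + (\<integral>x. (norm (G\<phi> n x))\<^sup>2 \<partial>mu0)) / 2" for n
  proof -
    have "(\<integral>x. (norm (G\<phi> n x))\<^sup>2 \<partial>mu0) = (\<Sum>i\<in>Basis. \<integral>x. (partial_deriv i (\<phi> n) x)\<^sup>2 \<partial>mu0)"
      unfolding G2 using dl[of _ n] by (intro Bochner_Integration.integral_sum) (auto simp: sq_integrable_def)
    then show ?thesis
      using gaussian_poincare_second_order[OF \<phi>[of n]] by (simp add: pd)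
  qed
  have "(\<integral>x. (u x)\<^sup>2 \<partial>mu0) - (\<integral>x. u x \<partial>mu0)\<^sup>2
      \<le> ((\<Sum>i\<in>Basis. (\<integral>x. G x \<bullet> i \<partial>mu0)\<^sup>2) + (\<integral>x. (norm (G x))\<^sup>2 \<partial>mu0)) / 2"
    by (rule LIMSEQ_le[OF tendsto_diff[OF A tendsto_power[OF M]]
          tendsto_divide[OF tendsto_add[OF tendsto_sum[OF tendsto_power[OF D]] B] tendsto_const]])
      (use ineq in auto)
  also have "(\<Sum>i\<in>Basis. (\<integral>x. G x \<bullet> i \<partial>mu0)\<^sup>2) = (norm (\<integral>x. G x \<partial>mu0))\<^sup>2"
    using iG by (simp add: norm_sq_eq_sum_Basis)
  finally show "(\<integral>x. (u x)\<^sup>2 \<partial>mu0) - (\<integral>x. u x \<partial>mu0)\<^sup>2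
       \<le> ((norm (\<integral>x. G x \<partial>mu0))\<^sup>2 + (\<integral>x. (norm (G x))\<^sup>2 \<partial>mu0)) / 2" .
qed

subsection \<open>Cut-off functions\<close>

text \<open>\<open>bump 0\<close> is the classical smooth function that is flat at 0. The powers
  s^(-k) are included so that derivatives remain linear combinations of members of the
  family.\<close>

definition bump :: "nat \<Rightarrow> real \<Rightarrow> real" where
  "bump k s = (if s > 0 then inverse s ^ k * exp (- inverse s) else 0)"

lemma bump_tendsto_0: "(bump k \<longlongrightarrow> 0) (at 0)"
proof (rule filterlim_split_at_real)
  show "(bump k \<longlongrightarrow> 0) (at_left 0)"
    by (rule tendsto_eventually) (auto simp: bump_def eventually_at_filter)
  have "((\<lambda>s. inverse s ^ k / exp (inverse s)) \<longlongrightarrow> 0) (at_right (0::real))"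
    by (rule filterlim_compose[OF tendsto_power_div_exp_0 filterlim_inverse_at_top_right])
  then show "(bump k \<longlongrightarrow> 0) (at_right 0)"
    by (rule Lim_transform_eventually)
      (auto simp: bump_def eventually_at_filter exp_minus divide_inverse)
qed

lemma bump_has_derivative:
  "(bump k has_real_derivative bump (k + 2) s - real k * bump (k + 1) s) (at s)"
proof -
  consider "s > 0" | "s < 0" | "s = 0" by linarith
  then show ?thesis
  proof cases
    case 1
    have "((\<lambda>s. inverse s ^ k * exp (- inverse s)) has_real_derivative bump (k + 2) s - real k * bump (k + 1) s) (at s)"
    proof (cases k)
      case 0
      with 1 show ?thesis
        by (auto intro!: derivative_eq_intros simp: bump_def power2_eq_square)
    next
      case (Suc l)
      with 1 show ?thesis
        by (auto intro!: derivative_eq_intros simp: bump_def power2_eq_square algebra_simps) (cases l; simp)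
    qed
    then show ?thesis
      by (rule has_field_derivative_transform_within_open[of _ _ _ "{0<..}"]) (use 1 in \<open>auto simp: bump_def\<close>)
  next
    case 2
    have "((\<lambda>s. 0) has_real_derivative 0) (at s)" by simp
    then have "(bump k has_real_derivative 0) (at s)"
      by (rule has_field_derivative_transform_within_open[of _ _ _ "{..<0}"]) (use 2 in \<open>auto simp: bump_def\<close>)
    with 2 show ?thesis by (simp add: bump_def)
  next
    case 3
    \<comment> \<open>Dividing by h raises the index: this quotient is
      \<open>bump (k + 1) h\<close>, whose limit at 0 is already known.\<close>
    have "((\<lambda>h. (bump k h - bump k 0) / (h - 0)) \<longlongrightarrow> 0) (at 0)"
      by (rule Lim_transform_eventually[OF bump_tendsto_0[of "k + 1"]])
        (auto simp: bump_def eventually_at_filter divide_inverse)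
    with 3 show ?thesis by (simp add: has_field_derivative_iff bump_def)
  qed
qed

lemma bump_nonneg: "bump k s \<ge> 0"
  by (simp add: bump_def)

lemma bump_0_le: "bump 0 s \<le> 1"
  by (simp add: bump_def)

text \<open>\<open>bump 2\<close> is the derivative of \<open>bump 0\<close>, so this bounds the
  gradient of the cut-off. With y = 1/s it says y^2 \<le> 2 exp y, which follows from the quadratic
  Taylor bound.\<close>

lemma bump_2_le: "bump 2 s \<le> 2"
proof (cases "s > 0")
  case True
  define y where "y = inverse s"
  have y: "y > 0" using True by (simp add: y_def)
  have "1 + y + y\<^sup>2 / 2 \<le> exp y" using exp_lower_Taylor_quadratic[of y] y by simp
  then have "y\<^sup>2 \<le> 2 * exp y" using y by simp
  then have "y\<^sup>2 * exp (- y) \<le> 2" by (simp add: exp_minus field_simps)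
  then show ?thesis using True by (simp add: bump_def y_def)
qed (simp add: bump_def)

text \<open>\<open>smooth_fun\<close> asks for a family of continuous functions closed under partial
  derivatives. This set is such a family, and it contains the polynomials and, for a > 0, cut-offs
  living on a|x|^2 < 1.\<close>

inductive_set bump_algebra :: "real \<Rightarrow> ('a::euclidean_space \<Rightarrow> real) set" for a where
  const: "(\<lambda>x. c) \<in> bump_algebra a"
| coord: "(\<lambda>x. x \<bullet> b) \<in> bump_algebra a"
| bump: "(\<lambda>x. bump k (1 - a * (norm x)\<^sup>2)) \<in> bump_algebra a"
| add: "f \<in> bump_algebra a \<Longrightarrow> g \<in> bump_algebra a \<Longrightarrow> (\<lambda>x. f x + g x) \<in> bump_algebra a"
| mult: "f \<in> bump_algebra a \<Longrightarrow> g \<in> bump_algebra a \<Longrightarrow> (\<lambda>x. f x * g x) \<in> bump_algebra a"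

text \<open>The derivative is written with sums, products and constants such as
  \<open>- real k\<close>, so that for a basis vector \<open>h\<close> it matches the introduction
  rules of \<open>bump_algebra\<close> literally.\<close>

lemma bump_comp_has_derivative:
  "((\<lambda>x. bump k (1 - a * (norm x)\<^sup>2)) has_derivative
    (\<lambda>h. (bump (k + 2) (1 - a * (norm x)\<^sup>2) + (- real k) * bump (k + 1) (1 - a * (norm x)\<^sup>2)) * ((- 2 * a) * (x \<bullet> h)))) (at x)"
proof -
  have "((\<lambda>x. 1 - a * (x \<bullet> x)) has_derivative (\<lambda>h. (- 2 * a) * (x \<bullet> h))) (at x)"
    by (auto intro!: derivative_eq_intros simp: inner_commute)
  then have "((\<lambda>x. 1 - a * (norm x)\<^sup>2) has_derivative (\<lambda>h. (- 2 * a) * (x \<bullet> h))) (at x)"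
    by (simp add: power2_norm_eq_inner)
  from diff_chain_at[OF this bump_has_derivative[unfolded has_field_derivative_def]]
  show ?thesis by (simp add: o_def)
qed

lemma bump_algebra_derivative:
  assumes "f \<in> bump_algebra a"
  shows "\<exists>f'. (\<forall>x. (f has_derivative f' x) (at x)) \<and> (\<forall>i\<in>Basis. (\<lambda>x. f' x i) \<in> bump_algebra a)"
  using assms
proof induction
  case (const c)
  show ?case
    by (rule exI[of _ "\<lambda>x h. 0"]) (auto intro: bump_algebra.const)
next
  case (coord b)
  show ?case
    by (rule exI[of _ "\<lambda>x h. h \<bullet> b"]) (auto intro!: derivative_eq_intros bump_algebra.const)
next
  case (bump k)
  show ?case
    by (rule exI, rule conjI, rule allI, rule bump_comp_has_derivative)
      (intro ballI bump_algebra.add bump_algebra.mult bump_algebra.const bump_algebra.coord bump_algebra.bump)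
next
  case (add f g)
  then obtain f' g' where *: "\<And>x. (f has_derivative f' x) (at x)" "\<And>i. i \<in> Basis \<Longrightarrow> (\<lambda>x. f' x i) \<in> bump_algebra a"
    "\<And>x. (g has_derivative g' x) (at x)" "\<And>i. i \<in> Basis \<Longrightarrow> (\<lambda>x. g' x i) \<in> bump_algebra a"
    by blast
  show ?case
    by (rule exI[of _ "\<lambda>x h. f' x h + g' x h"]) (auto intro!: has_derivative_add bump_algebra.add *)
next
  case (mult f g)
  then obtain f' g' where *: "\<And>x. (f has_derivative f' x) (at x)" "\<And>i. i \<in> Basis \<Longrightarrow> (\<lambda>x. f' x i) \<in> bump_algebra a"
    "\<And>x. (g has_derivative g' x) (at x)" "\<And>i. i \<in> Basis \<Longrightarrow> (\<lambda>x. g' x i) \<in> bump_algebra a"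
    by blast
  show ?case
    by (rule exI[of _ "\<lambda>x h. f x * g' x h + f' x h * g x"])
      (auto intro!: has_derivative_mult bump_algebra.add bump_algebra.mult * mult.hyps)
qed

lemma bump_algebra_smooth:
  assumes "f \<in> bump_algebra a"
  shows "smooth_fun f"
  unfolding smooth_fun_def
proof (intro exI[of _ "bump_algebra a"] conjI ballI)
  show "f \<in> bump_algebra a" by fact
  fix g assume "g \<in> bump_algebra a"
  from bump_algebra_derivative[OF this] show *: "\<exists>g'. (\<forall>x. (g has_derivative g' x) (at x)) \<and> (\<forall>i\<in>Basis. (\<lambda>x. g' x i) \<in> bump_algebra a)" .
  from * show "continuous_on UNIV g"
    by (meson has_derivative_continuous continuous_at_imp_continuous_on)
qed

lemma bump_algebra_sum:
  assumes "finite I" "\<And>i. i \<in> I \<Longrightarrow> f i \<in> bump_algebra a"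
  shows "(\<lambda>x. \<Sum>i\<in>I. f i x) \<in> bump_algebra a"
  using assms by (induction I rule: finite_induct) (auto intro: bump_algebra.const bump_algebra.add)

subsection \<open>The extremal function\<close>

text \<open>The factor e normalises the cut-off to 1 in the limit.\<close>

lemma X0_norm_sq: "X0 (\<lambda>x::'a::euclidean_space. (norm x)\<^sup>2) (\<lambda>x. 2 *\<^sub>R x)"
proof -
  define \<psi> where "\<psi> n k x = exp 1 * bump k (1 - inverse (real (Suc n)) * (norm x)\<^sup>2)" for n k and x :: 'a
  define \<phi> where "\<phi> n x = (norm x)\<^sup>2 * \<psi> n 0 x" for n and x :: 'a
  \<comment> \<open>The gradient of \<open>\<phi> n\<close> at x is radial and \<open>g n x\<close>
    is its coefficient: 2 times the cut-off from differentiating |x|^2, plus the term where the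
    cut-off is differentiated, which turns \<open>bump 0\<close> into \<open>bump 2\<close>.\<close>
  define g where "g n x = 2 * \<psi> n 0 x + - 2 * inverse (real (Suc n)) * (norm x)\<^sup>2 * \<psi> n 2 x" for n and x :: 'a
  have \<psi>_bound: "\<bar>\<psi> n 0 x\<bar> \<le> exp 1" "\<bar>\<psi> n 2 x\<bar> \<le> exp 1 * 2" for n x
    using bump_nonneg bump_0_le bump_2_le by (simp_all add: \<psi>_def abs_mult)
  have arg: "(\<lambda>n. 1 - inverse (real (Suc n)) * (norm x)\<^sup>2) \<longlonglongrightarrow> 1" for x :: 'a
    using tendsto_diff[OF tendsto_const tendsto_mult_left_zero[OF LIMSEQ_inverse_real_of_nat], of 1] by simp
  have \<psi>_lim: "(\<lambda>n. \<psi> n 0 x) \<longlonglongrightarrow> 1" for x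
  proof -
    have "isCont (bump 0) 1" using bump_has_derivative DERIV_isCont by blast
    from isCont_tendsto_compose[OF this arg[of x]]
    have "(\<lambda>n. exp 1 * bump 0 (1 - inverse (real (Suc n)) * (norm x)\<^sup>2)) \<longlonglongrightarrow> exp 1 * bump 0 1"
      by (rule tendsto_mult_left)
    then show ?thesis by (simp add: \<psi>_def bump_def flip: exp_add)
  qed
  have [measurable]: "\<psi> n k \<in> borel_measurable borel" for n k
  proof -
    have "continuous_on UNIV (bump k)"
      using bump_has_derivative DERIV_isCont by (blast intro: continuous_at_imp_continuous_on)
    then have [measurable]: "bump k \<in> borel_measurable borel" by (rule borel_measurable_continuous_onI)
    show ?thesis unfolding \<psi>_def[abs_def] by measurable
  qed
  have smooth: "\<phi> n \<in> Cc_inf" for n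
  proof -
    have "\<phi> n = (\<lambda>x. (\<Sum>b\<in>Basis. (x \<bullet> b) * (x \<bullet> b)) * (exp 1 * bump 0 (1 - inverse (real (Suc n)) * (norm x)\<^sup>2)))"
    proof
      fix x :: 'a
      have "(\<Sum>b\<in>Basis. (x \<bullet> b) * (x \<bullet> b)) = (norm x)\<^sup>2"
        by (simp only: power2_norm_eq_inner euclidean_inner[of x x])
      then show "\<phi> n x = (\<Sum>b\<in>Basis. (x \<bullet> b) * (x \<bullet> b)) * (exp 1 * bump 0 (1 - inverse (real (Suc n)) * (norm x)\<^sup>2))"
        by (simp only: \<phi>_def \<psi>_def)
    qed
    also have "\<dots> \<in> bump_algebra (inverse (real (Suc n)))"
      by (intro bump_algebra.mult bump_algebra_sum bump_algebra.intros finite_Basis)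
    finally have "smooth_fun (\<phi> n)" by (rule bump_algebra_smooth)
    moreover have "{x. \<phi> n x \<noteq> 0} \<subseteq> cball 0 (real (Suc n))"
    proof
      fix x assume "x \<in> {x. \<phi> n x \<noteq> 0}"
      then have "1 - inverse (real (Suc n)) * (norm x)\<^sup>2 > 0"
        by (auto simp: \<phi>_def \<psi>_def bump_def split: if_splits)
      then have "(norm x)\<^sup>2 \<le> real (Suc n)" by (simp add: field_simps)
      also have "\<dots> \<le> (real (Suc n))\<^sup>2" by (simp add: power2_eq_square)
      finally have "norm x \<le> real (Suc n)" by (rule power2_le_imp_le) simp
      then show "x \<in> cball 0 (real (Suc n))" by simp
    qed
    then have "closure {x. \<phi> n x \<noteq> 0} \<subseteq> cball 0 (real (Suc n))"
      by (rule closure_minimal) simp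
    then have "compact (closure {x. \<phi> n x \<noteq> 0})"
      by (meson bounded_cball bounded_subset compact_eq_bounded_closed closed_closure)
    ultimately show ?thesis by (simp add: Cc_inf_def)
  qed
  have deriv: "(\<phi> n has_derivative (\<lambda>h. (g n x *\<^sub>R x) \<bullet> h)) (at x)" for n x
  proof -
    have 1: "((\<lambda>x. (norm x)\<^sup>2) has_derivative (\<lambda>h. 2 * (x \<bullet> h))) (at x)"
      unfolding power2_norm_eq_inner by (auto intro!: derivative_eq_intros simp: inner_commute)
    have 2: "(\<psi> n 0 has_derivative (\<lambda>h. exp 1 * (bump 2 (1 - inverse (real (Suc n)) * (norm x)\<^sup>2)
        * (- 2 * inverse (real (Suc n)) * (x \<bullet> h))))) (at x)"
      using has_derivative_mult_right[OF bump_comp_has_derivative[of 0 "inverse (real (Suc n))" x], of "exp 1"]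
      by (simp add: \<psi>_def[abs_def] numeral_2_eq_2 mult.assoc)
    show ?thesis
      using has_derivative_mult[OF 1 2] unfolding \<phi>_def[abs_def]
      by (rule has_derivative_eq_rhs) (simp add: fun_eq_iff g_def \<psi>_def algebra_simps)
  qed
  \<comment> \<open>Dominated convergence in L^2, shared by the function and its gradient: an
    exponentially bounded majorant has an integrable square.\<close>
  have dom: "(\<lambda>n. \<integral>\<^sup>+ x. ennreal ((f n x)\<^sup>2) \<partial>mu0) \<longlonglongrightarrow> 0"
    if m: "\<And>n. f n \<in> borel_measurable borel" and b: "\<And>n x. \<bar>f n x\<bar> \<le> w x"
      and w: "exp_bounded w" "w \<in> borel_measurable borel" and l: "\<And>x. (\<lambda>n. f n x) \<longlonglongrightarrow> 0"
    for f :: "nat \<Rightarrow> 'a \<Rightarrow> real" and w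
  proof -
    have int: "integrable mu0 (\<lambda>x. (w x)\<^sup>2)"
      using w by (intro integrable_exp_bounded exp_bounded_power) auto
    have "(\<lambda>n. \<integral>\<^sup>+ x. ennreal ((f n x)\<^sup>2) \<partial>mu0) \<longlonglongrightarrow> (\<integral>\<^sup>+ x. ennreal 0 \<partial>(mu0 :: 'a measure))"
    proof (rule nn_integral_dominated_convergence[where w = "\<lambda>x. ennreal ((w x)\<^sup>2)"])
      show "AE x in mu0. ennreal ((f n x)\<^sup>2) \<le> ennreal ((w x)\<^sup>2)" for n
      proof (intro AE_I2 ennreal_leI)
        fix x
        have "\<bar>f n x\<bar>\<^sup>2 \<le> (w x)\<^sup>2" by (rule power_mono[OF b]) simp
        then show "(f n x)\<^sup>2 \<le> (w x)\<^sup>2" by simp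
      qed
      show "(\<integral>\<^sup>+ x. ennreal ((w x)\<^sup>2) \<partial>mu0) < \<infinity>"
        using int by (subst nn_integral_eq_integral) auto
      show "AE x in mu0. (\<lambda>n. ennreal ((f n x)\<^sup>2)) \<longlonglongrightarrow> ennreal 0"
        using tendsto_power[OF l, of _ 2] by (intro AE_I2 tendsto_ennrealI) simp
    qed (use m w in auto)
    then show ?thesis by simp
  qed
  have eb: "exp_bounded (\<lambda>x::'a. c * norm x ^ k)" for c k
    by (intro exp_bounded_mult exp_bounded_const exp_bounded_power exp_bounded_norm)
  have lim1: "(\<lambda>n. \<integral>\<^sup>+ x. ennreal ((\<phi> n x - (norm x)\<^sup>2)\<^sup>2) \<partial>mu0) \<longlonglongrightarrow> 0"
  proof (rule dom)
    show "exp_bounded (\<lambda>x::'a. (exp 1 + 1) * norm x ^ 2)" by (rule eb)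
    show "\<bar>\<phi> n x - (norm x)\<^sup>2\<bar> \<le> (exp 1 + 1) * norm x ^ 2" for n x
    proof -
      have "\<bar>\<psi> n 0 x - 1\<bar> \<le> exp 1 + 1" using \<psi>_bound(1)[of n x] by linarith
      then have "norm x ^ 2 * \<bar>\<psi> n 0 x - 1\<bar> \<le> norm x ^ 2 * (exp 1 + 1)" by (rule mult_left_mono) simp
      moreover have "\<phi> n x - (norm x)\<^sup>2 = norm x ^ 2 * (\<psi> n 0 x - 1)" by (simp add: \<phi>_def algebra_simps)
      ultimately show ?thesis by (simp add: abs_mult mult.commute)
    qed
    show "(\<lambda>n. \<phi> n x - (norm x)\<^sup>2) \<longlonglongrightarrow> 0" for x
      using tendsto_diff[OF tendsto_mult[OF tendsto_const \<psi>_lim[of x]] tendsto_const, of "(norm x)\<^sup>2" "(norm x)\<^sup>2"]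
      by (simp add: \<phi>_def)
    show "(\<lambda>x. \<phi> n x - (norm x)\<^sup>2) \<in> borel_measurable borel" for n
      unfolding \<phi>_def by measurable
  qed measurable
  \<comment> \<open>Approximate and limit gradients are both multiples of x, so the norm of their
    difference is the absolute value of this scalar expression.\<close>
  have "(\<lambda>n. \<integral>\<^sup>+ x. ennreal (((g n x - 2) * norm x)\<^sup>2) \<partial>mu0) \<longlonglongrightarrow> 0"
  proof (rule dom)
    \<comment> \<open>Since 1 / (n + 1) \<le> 1, the bounds e and 2e on the two cut-offs give |g -
      2| \<le> 2e + 2 + 4e|x|^2; the remaining factor is |x|. The power 1 is kept visible so that
      \<open>eb\<close> applies.\<close>
    show "exp_bounded (\<lambda>x::'a. (2 * exp 1 + 2) * norm x ^ 1 + 4 * exp 1 * norm x ^ 3)"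
      by (intro exp_bounded_add eb)
    show "\<bar>(g n x - 2) * norm x\<bar> \<le> (2 * exp 1 + 2) * norm x ^ 1 + 4 * exp 1 * norm x ^ 3" for n x
    proof -
      have i: "inverse (real (Suc n)) \<le> 1" "inverse (real (Suc n)) \<ge> 0" by (simp_all add: field_simps)
      have "\<bar>inverse (real (Suc n)) * (norm x)\<^sup>2 * \<psi> n 2 x\<bar> \<le> 1 * (norm x)\<^sup>2 * (exp 1 * 2)"
        unfolding abs_mult using i \<psi>_bound(2)[of n x] by (intro mult_mono) auto
      moreover have "1 * (norm x)\<^sup>2 * (exp 1 * 2) * 2 = 4 * exp 1 * (norm x)\<^sup>2" by simp
      moreover have "g n x - 2 = 2 * \<psi> n 0 x - 2 * (inverse (real (Suc n)) * (norm x)\<^sup>2 * \<psi> n 2 x) - 2"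
        by (simp add: g_def)
      ultimately have "\<bar>g n x - 2\<bar> \<le> (2 * exp 1 + 2) + 4 * exp 1 * (norm x)\<^sup>2"
        using \<psi>_bound(1)[of n x] by linarith
      then have "\<bar>g n x - 2\<bar> * norm x \<le> ((2 * exp 1 + 2) + 4 * exp 1 * (norm x)\<^sup>2) * norm x"
        by (rule mult_right_mono) simp
      also have "\<dots> = (2 * exp 1 + 2) * norm x ^ 1 + 4 * exp 1 * norm x ^ 3"
        by (simp add: algebra_simps power3_eq_cube power2_eq_square)
      finally show ?thesis by (simp only: abs_mult abs_norm_cancel)
    qed
    show "(\<lambda>n. (g n x - 2) * norm x) \<longlonglongrightarrow> 0" for x
    proof -
      have "(\<lambda>n. inverse (real (Suc n)) * (norm x)\<^sup>2 * \<psi> n 2 x) \<longlonglongrightarrow> 0"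
      proof (rule Lim_null_comparison)
        show "(\<lambda>n. inverse (real (Suc n)) * ((norm x)\<^sup>2 * (exp 1 * 2))) \<longlonglongrightarrow> 0"
          by (rule tendsto_mult_left_zero[OF LIMSEQ_inverse_real_of_nat])
        show "\<forall>\<^sub>F n in sequentially. norm (inverse (real (Suc n)) * (norm x)\<^sup>2 * \<psi> n 2 x)
            \<le> inverse (real (Suc n)) * ((norm x)\<^sup>2 * (exp 1 * 2))"
          unfolding real_norm_def abs_mult mult.assoc using \<psi>_bound(2)
          by (intro always_eventually allI mult_mono) auto
      qed
      from tendsto_mult_left_zero[OF tendsto_diff[OF tendsto_diff[OF tendsto_mult[OF tendsto_const[of 2] \<psi>_lim[of x]] tendsto_mult[OF tendsto_const[of 2] this]] tendsto_const[of 2], simplified], of "norm x"]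
      show ?thesis by (simp add: g_def mult.assoc)
    qed
    show "(\<lambda>x. (g n x - 2) * norm x) \<in> borel_measurable borel" for n
      unfolding g_def by measurable
  qed measurable
  moreover have "(norm (g n x *\<^sub>R x - 2 *\<^sub>R x))\<^sup>2 = ((g n x - 2) * norm x)\<^sup>2" for n x
    by (simp add: power_mult_distrib flip: scaleR_diff_left)
  ultimately have lim2: "(\<lambda>n. \<integral>\<^sup>+ x. ennreal ((norm (g n x *\<^sub>R x - 2 *\<^sub>R x))\<^sup>2) \<partial>mu0) \<longlonglongrightarrow> 0"
    by (simp only:)
  show ?thesis
    unfolding X0_def
    by (intro conjI exI[of _ \<phi>] exI[of _ "\<lambda>n x. g n x *\<^sub>R x"] allI smooth deriv lim1 lim2) measurable
qed

section \<open>Moments of |x|^2\<close>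

lemma exp_bounded_norm_sq: "exp_bounded (\<lambda>x. (norm x)\<^sup>2)"
  by (intro exp_bounded_power exp_bounded_norm)

lemma norm_sq_line:
  assumes "norm i = 1"
  shows "(norm (x + t *\<^sub>R i))\<^sup>2 = (norm x)\<^sup>2 + 2 * t * (x \<bullet> i) + t\<^sup>2"
  using assms
  by (simp add: power2_norm_eq_inner norm_eq_1 inner_add_left inner_add_right inner_commute power2_eq_square[of t])

lemma integral_norm_sq: "(\<integral>x. (norm x)\<^sup>2 \<partial>(mu0 :: 'a::euclidean_space measure)) = real DIM('a)"
proof -
  have "(\<integral>x. (norm x)\<^sup>2 \<partial>(mu0 :: 'a measure)) = (\<Sum>b\<in>Basis. \<integral>x. (x \<bullet> b)\<^sup>2 \<partial>(mu0 :: 'a measure))"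
    unfolding norm_sq_eq_sum_Basis
    by (intro Bochner_Integration.integral_sum integrable_exp_bounded exp_bounded_power exp_bounded_inner) auto
  then show ?thesis by (simp add: integral_mu0_inner_sq)
qed

text \<open>Split |x|^4 into the terms x_i (x_i |x|^2) and integrate each by parts: the derivative
  |x|^2 + 2 x_i^2 has mean N + 2, and there are N terms.\<close>

lemma integral_norm_pow4:
  "(\<integral>x. ((norm x)\<^sup>2)\<^sup>2 \<partial>(mu0 :: 'a::euclidean_space measure)) = real DIM('a) ^ 2 + 2 * real DIM('a)"
proof -
  let ?mu = "mu0 :: 'a measure"
  have ibp: "(\<integral>x. (x \<bullet> i) * ((x \<bullet> i) * (norm x)\<^sup>2) \<partial>?mu) = real DIM('a) + 2" if i: "i \<in> Basis" for i
  proof -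
    have n: "norm i = 1" "i \<bullet> i = 1" using i by auto
    have "(\<integral>x. (x \<bullet> i) * ((x \<bullet> i) * (norm x)\<^sup>2) \<partial>?mu) = (\<integral>x. (norm x)\<^sup>2 + 2 * (x \<bullet> i)\<^sup>2 \<partial>?mu)"
    proof (rule gaussian_integration_by_parts[OF n(1)])
      show "((\<lambda>t. ((x + t *\<^sub>R i) \<bullet> i) * (norm (x + t *\<^sub>R i))\<^sup>2) has_real_derivative
          (norm x)\<^sup>2 + 2 * (x \<bullet> i)\<^sup>2) (at 0)" for x
        unfolding norm_sq_line[OF n(1)] inner_add_left inner_scaleR_left n(2)
        by (auto intro!: derivative_eq_intros simp: power2_eq_square)
      show "exp_bounded (\<lambda>x. (x \<bullet> i) * (norm x)\<^sup>2)"
        by (intro exp_bounded_mult exp_bounded_inner exp_bounded_norm_sq)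
      show "exp_bounded (\<lambda>x. (norm x)\<^sup>2 + 2 * (x \<bullet> i)\<^sup>2)"
        by (intro exp_bounded_add exp_bounded_mult exp_bounded_const exp_bounded_power exp_bounded_inner exp_bounded_norm_sq)
    qed measurable
    also have "\<dots> = real DIM('a) + 2"
    proof -
      have "integrable ?mu (\<lambda>x. (norm x)\<^sup>2)" "integrable ?mu (\<lambda>x. (x \<bullet> i)\<^sup>2)"
        by (intro integrable_exp_bounded exp_bounded_norm_sq exp_bounded_power exp_bounded_inner; measurable)+
      then show ?thesis by (simp add: integral_norm_sq integral_mu0_inner_sq n)
    qed
    finally show ?thesis .
  qed
  have "(\<integral>x. ((norm x)\<^sup>2)\<^sup>2 \<partial>?mu) = (\<integral>x. (\<Sum>i\<in>Basis. (x \<bullet> i) * ((x \<bullet> i) * (norm x)\<^sup>2)) \<partial>?mu)"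
  proof (intro Bochner_Integration.integral_cong refl)
    fix x :: 'a
    have "(\<Sum>i\<in>Basis. (x \<bullet> i) * ((x \<bullet> i) * (norm x)\<^sup>2)) = (\<Sum>i\<in>Basis. (x \<bullet> i) * (x \<bullet> i)) * (norm x)\<^sup>2"
      by (simp only: sum_distrib_right mult.assoc)
    also have "(\<Sum>i\<in>Basis. (x \<bullet> i) * (x \<bullet> i)) = (norm x)\<^sup>2"
      by (simp only: power2_norm_eq_inner euclidean_inner[of x x])
    also have "(norm x)\<^sup>2 * (norm x)\<^sup>2 = ((norm x)\<^sup>2)\<^sup>2"
      by (rule power2_eq_square[symmetric])
    finally show "((norm x)\<^sup>2)\<^sup>2 = (\<Sum>i\<in>Basis. (x \<bullet> i) * ((x \<bullet> i) * (norm x)\<^sup>2))"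
      by (rule sym)
  qed
  also have "\<dots> = (\<Sum>i\<in>Basis. \<integral>x. (x \<bullet> i) * ((x \<bullet> i) * (norm x)\<^sup>2) \<partial>?mu)"
    by (intro Bochner_Integration.integral_sum integrable_exp_bounded exp_bounded_mult exp_bounded_inner
        exp_bounded_norm_sq) measurable
  also have "\<dots> = (\<Sum>i\<in>(Basis :: 'a set). real DIM('a) + 2)"
    by (rule sum.cong[OF refl ibp])
  also have "\<dots> = real DIM('a) ^ 2 + 2 * real DIM('a)"
    by (simp add: power2_eq_square algebra_simps)
  finally show ?thesis .
qed

lemma integrable_norm_sq_scaleR: "integrable mu0 (\<lambda>x::'a::euclidean_space. (norm x)\<^sup>2 *\<^sub>R x)"
  by (rule Bochner_Integration.integrable_bound[of _ "\<lambda>x. (norm x)\<^sup>2 * norm x"])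
    (auto intro!: integrable_exp_bounded exp_bounded_mult exp_bounded_norm_sq)

text \<open>The vector c of the extremal function vanishes, since by parts its coordinates are means
  of 2 x_i.\<close>

lemma integral_norm_sq_scaleR: "(\<integral>x. (norm x)\<^sup>2 *\<^sub>R x \<partial>(mu0 :: 'a::euclidean_space measure)) = 0"
proof (rule euclidean_eqI)
  fix i :: 'a assume "i \<in> Basis"
  then have n: "norm i = 1" by simp
  have "(\<integral>x. (x \<bullet> i) * (norm x)\<^sup>2 \<partial>(mu0 :: 'a measure)) = (\<integral>x. 2 * (x \<bullet> i) \<partial>mu0)"
  proof (rule gaussian_integration_by_parts[OF n])
    show "((\<lambda>t. (norm (x + t *\<^sub>R i))\<^sup>2) has_real_derivative 2 * (x \<bullet> i)) (at 0)" for x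
      unfolding norm_sq_line[OF n] by (auto intro!: derivative_eq_intros)
    show "exp_bounded (\<lambda>x. 2 * (x \<bullet> i))"
      by (intro exp_bounded_mult exp_bounded_const exp_bounded_inner)
  qed (auto intro: exp_bounded_norm_sq)
  then have "(\<integral>x. ((norm x)\<^sup>2 *\<^sub>R x) \<bullet> i \<partial>(mu0 :: 'a measure)) = 0"
    by (simp add: integral_mu0_inner mult.commute)
  then show "(\<integral>x. (norm x)\<^sup>2 *\<^sub>R x \<partial>(mu0 :: 'a measure)) \<bullet> i = 0 \<bullet> i"
    by (simp only: integral_inner_left[OF integrable_norm_sq_scaleR] inner_zero_left)
qed

text \<open>Elements of \<open>X0\<close> matter only up to null sets, so moments are compared
  instead of values. Integrating the supposed equation gives a = N; multiplying it by |x|^2 and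
  integrating again gives N^2 for the fourth moment, which is N^2 + 2N.\<close>

lemma norm_sq_not_affine:
  "\<not> (\<exists>a b. AE x in (mu0 :: 'a::euclidean_space measure). (norm x)\<^sup>2 = a + b \<bullet> x)"
proof
  let ?mu = "mu0 :: 'a measure"
  assume "\<exists>a b. AE x in ?mu. (norm x)\<^sup>2 = a + b \<bullet> x"
  then obtain a b where ab: "AE x in ?mu. (norm x)\<^sup>2 = a + b \<bullet> x" by blast
  have int: "integrable ?mu (\<lambda>x. x \<bullet> b)" "integrable ?mu (\<lambda>x. (norm x)\<^sup>2)"
    by (intro integrable_exp_bounded exp_bounded_norm_sq exp_bounded_inner; measurable)+
  have "(\<integral>x. (norm x)\<^sup>2 \<partial>?mu) = (\<integral>x. a + x \<bullet> b \<partial>?mu)"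
    by (rule integral_cong_AE) (use ab in \<open>auto simp: inner_commute\<close>)
  then have a: "a = real DIM('a)"
    using int by (simp add: integral_norm_sq integral_mu0_inner)
  have "(\<integral>x. ((norm x)\<^sup>2)\<^sup>2 \<partial>?mu) = (\<integral>x. a * (norm x)\<^sup>2 + ((norm x)\<^sup>2 *\<^sub>R x) \<bullet> b \<partial>?mu)"
  proof (rule integral_cong_AE)
    show "AE x in ?mu. ((norm x)\<^sup>2)\<^sup>2 = a * (norm x)\<^sup>2 + ((norm x)\<^sup>2 *\<^sub>R x) \<bullet> b"
      using ab
    proof eventually_elim
      case (elim x)
      have "((norm x)\<^sup>2)\<^sup>2 = (a + b \<bullet> x) * (norm x)\<^sup>2"
        unfolding power2_eq_square[of "(norm x)\<^sup>2"] by (subst elim) simp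
      then show ?case by (simp add: algebra_simps inner_commute)
    qed
  qed measurable
  also have "\<dots> = a * real DIM('a)"
    using int integrable_inner_left[OF integrable_norm_sq_scaleR, of b]
      integral_inner_left[OF integrable_norm_sq_scaleR, of b]
    by (simp add: integral_norm_sq integral_norm_sq_scaleR del: inner_scaleR_left)
  finally show False
    unfolding integral_norm_pow4 a using DIM_positive[where 'a='a] by (simp add: power2_eq_square)
qed

theorem theorem1p6:
  shows "(\<forall>(u :: 'a::euclidean_space \<Rightarrow> real) G. X0 u G \<longrightarrow>
      (let m = (\<integral>x. u x \<partial>mu0); c = (\<integral>x. u x *\<^sub>R x \<partial>mu0) in
        (\<integral>x. (norm (G x))\<^sup>2 \<partial>mu0) - (\<integral>x. (u x - m)\<^sup>2 \<partial>mu0)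
          \<ge> 1/2 * (\<integral>x. (norm (G x - c))\<^sup>2 \<partial>mu0)
        \<and> 1/2 * (\<integral>x. (norm (G x - c))\<^sup>2 \<partial>mu0)
          \<ge> (\<integral>x. (u x - m - c \<bullet> x)\<^sup>2 \<partial>mu0)))
    \<and> (\<exists>(u :: 'a \<Rightarrow> real) G. X0 u G \<and>
        \<not> (\<exists>a b. AE x in mu0. u x = a + b \<bullet> x) \<and>
      (let m = (\<integral>x. u x \<partial>mu0); c = (\<integral>x. u x *\<^sub>R x \<partial>mu0) in
        (\<integral>x. (norm (G x))\<^sup>2 \<partial>mu0) - (\<integral>x. (u x - m)\<^sup>2 \<partial>mu0)
          = 1/2 * (\<integral>x. (norm (G x - c))\<^sup>2 \<partial>mu0)
        \<and> 1/2 * (\<integral>x. (norm (G x - c))\<^sup>2 \<partial>mu0)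
          = (\<integral>x. (u x - m - c \<bullet> x)\<^sup>2 \<partial>mu0)))"
proof (intro conjI allI impI)
  fix u :: "'a \<Rightarrow> real" and G
  assume X: "X0 u G"
  note X = X0_inequality[OF X]
  show "let m = (\<integral>x. u x \<partial>mu0); c = (\<integral>x. u x *\<^sub>R x \<partial>mu0) in
        (\<integral>x. (norm (G x))\<^sup>2 \<partial>mu0) - (\<integral>x. (u x - m)\<^sup>2 \<partial>mu0)
          \<ge> 1/2 * (\<integral>x. (norm (G x - c))\<^sup>2 \<partial>mu0)
        \<and> 1/2 * (\<integral>x. (norm (G x - c))\<^sup>2 \<partial>mu0)
          \<ge> (\<integral>x. (u x - m - c \<bullet> x)\<^sup>2 \<partial>mu0)"
    unfolding Let_def gaussian_identities[OF X(1-3)] using X(4)[unfolded X(3)] by argo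
next
  let ?u = "\<lambda>x::'a. (norm x)\<^sup>2" and ?G = "\<lambda>x::'a. 2 *\<^sub>R x"
  note X = X0_inequality[OF X0_norm_sq[where 'a='a]]
  have B: "(\<integral>x. (norm (?G x))\<^sup>2 \<partial>mu0) = 4 * real DIM('a)"
    by (simp add: power_mult_distrib integral_norm_sq)
  \<comment> \<open>For |x|^2 all three expressions equal 2N: the gradient contributes 4N, the
    variance is N^2 + 2N - N^2, and c = 0.\<close>
  have "let m = (\<integral>x. ?u x \<partial>mu0); c = (\<integral>x. ?u x *\<^sub>R x \<partial>mu0) in
        (\<integral>x. (norm (?G x))\<^sup>2 \<partial>mu0) - (\<integral>x. (?u x - m)\<^sup>2 \<partial>mu0)
          = 1/2 * (\<integral>x. (norm (?G x - c))\<^sup>2 \<partial>mu0)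
        \<and> 1/2 * (\<integral>x. (norm (?G x - c))\<^sup>2 \<partial>mu0)
          = (\<integral>x. (?u x - m - c \<bullet> x)\<^sup>2 \<partial>mu0)"
    unfolding Let_def gaussian_identities[OF X(1-3)]
    unfolding B integral_norm_pow4 integral_norm_sq_scaleR integral_norm_sq
    by simp
  with X0_norm_sq norm_sq_not_affine
  show "\<exists>(u :: 'a \<Rightarrow> real) G. X0 u G \<and>
        \<not> (\<exists>a b. AE x in mu0. u x = a + b \<bullet> x) \<and>
      (let m = (\<integral>x. u x \<partial>mu0); c = (\<integral>x. u x *\<^sub>R x \<partial>mu0) in
        (\<integral>x. (norm (G x))\<^sup>2 \<partial>mu0) - (\<integral>x. (u x - m)\<^sup>2 \<partial>mu0)
          = 1/2 * (\<integral>x. (norm (G x - c))\<^sup>2 \<partial>mu0)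
        \<and> 1/2 * (\<integral>x. (norm (G x - c))\<^sup>2 \<partial>mu0)
          = (\<integral>x. (u x - m - c \<bullet> x)\<^sup>2 \<partial>mu0))"
    by (intro exI[of _ ?u] exI[of _ ?G] conjI)
qed

end
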